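(* Let $D=D_1\times D_2$ with $D_1\subset\mathbb{C}^{n_1}$, $D_2\subset\mathbb{C}^{n_2}$ bounded domains, and let $\alpha=(\alpha_1,\alpha_2)$ with $0<\alpha_1,\alpha_2<1$. For $j=1,2$, assume there is a bounded linear operator $T_j:L^\infty_{(0,1)}(D_j)\to\Lambda^{\alpha_j}(D_j)$ that solves the $\bar\partial_j$-equation on $D_j$ and commutes with the barred derivatives in the variables of the other factor. Let $f$ be a weakly $\bar\partial$-closed $(0,1)$-form on $D$. If $f_{\{1,2\}}\in L^\infty(D)$, $f_{\{1\}}\in L^\infty(D_1)\otimes\Lambda^{\alpha_2}(D_2)$, and $f_{\{2\}}\in\Lambda^{\alpha_1}(D_1)\otimes L^\infty(D_2)$, then there exists a solution $u=T(f)$ of $\bar\partial u=f$ on $D$ satisfying $$\|u\|_{\Lambda^\alpha_2(D)}\le C_\alpha\left(\|f_{\{1\}}\|_{L^\infty(D_1)\otimes\Lambda^{\alpha_2}(D_2)}+\|f_{\{2\}}\|_{\Lambda^{\alpha_1}(D_1)\otimes L^\infty(D_2)}+\|f_{\{1,2\}}\|_{L^\infty(D)}\right),$$ with $C_\alpha$ independent of $f$.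
   Context: Coordinates: $z^j=(z^j_1,\dots,z^j_{n_j})\in D_j$, $j=1,2$. $\bar\partial=\bar\partial_1+\bar\partial_2$ with $\bar\partial_j u=\sum_m\frac{\partial u}{\partial\bar z^j_m}d\bar z^j_m$. Write $f=\sum_{j=1}^2\sum_{m=1}^{n_j}f^j_m\,d\bar z^j_m$. All derivatives are distributional. $f_{\{j\}}$ denotes the class of coefficients $f^j_m$, $1\le m\le n_j$; $f_{\{1,2\}}$ denotes the class of derivatives $\partial f^1_m/\partial\bar z^2_{m'}$ (equal to $\partial f^2_{m'}/\partial\bar z^1_m$ since $\bar\partial f=0$), $1\le m\le n_1$, $1\le m'\le n_2$. $f_I\in X$ means every member of the class is in $X$, and $\|f_I\|_X$ is the sum of the norms of all members. For $0<\beta<1$, $\Lambda^\beta(D_j)$ is the classical Hölder space with norm $\|g\|_{\Lambda^\beta(D_j)}=\|g\|_{L^\infty(D_j)}+\sup_{z\ne w\in D_j}\frac{|g(z)-g(w)|}{|z-w|^\beta}$. The 2-iterated Hölder space $\Lambda^\alpha_2(D)$ is the set of $g\in L^\infty(D)$ with finite norm $\|g\|_{\Lambda^\alpha_2(D)}=\|g\|_{L^\infty(D)}+\|g\|_\alpha$, where $$\|g\|_\alpha=\sup_{z^1\ne w^1\in D_1}\ \sup_{z^2\ne w^2\in D_2}\frac{|g(z^1,z^2)-g(w^1,z^2)-g(z^1,w^2)+g(w^1,w^2)|}{|z^1-w^1|^{\alpha_1}|z^2-w^2|^{\alpha_2}}.$$ $L^\infty(D_1)\otimes\Lambda^{\alpha_2}(D_2)$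 is the space of functions $g$ on $D$ with finite norm $$\|g\|_{L^\infty(D_1)\otimes\Lambda^{\alpha_2}(D_2)}=\|g\|_{L^\infty(D)}+\sup_{z^2\ne w^2\in D_2}\frac{\|g(\cdot,z^2)-g(\cdot,w^2)\|_{L^\infty(D_1)}}{|z^2-w^2|^{\alpha_2}},$$ and $\Lambda^{\alpha_1}(D_1)\otimes L^\infty(D_2)$ is defined symmetrically. "$T_j$ solves the $\bar\partial_j$-equation" means $\bar\partial_j(T_j\beta)=\beta$ for every $\bar\partial_j$-closed $\beta\in L^\infty_{(0,1)}(D_j)$. $T_j$ acts on forms in $d\bar z^j_1,\dots,d\bar z^j_{n_j}$ with coefficients bounded functions on $D$ by treating the variables of the other factor as parameters. "$T_j$ commutes with the barred derivatives in the variables of the other factor" means $\frac{\partial}{\partial\bar z^i_m}T_j(g)=T_j\big(\frac{\partial g}{\partial\bar z^i_m}\big)$ ($i\neq j$) for such $g$ whenever $g$ and $\partial g/\partial\bar z^i_m$ have coefficients in $L^\infty(D)$. *)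

theory Defs
  imports "HOL-Analysis.Analysis" "HOL-Probability.Essential_Supremum"
begin

definition bounded_domain :: "'e::euclidean_space set \<Rightarrow> bool" where
  "bounded_domain S \<longleftrightarrow> open S \<and> connected S \<and> S \<noteq> {} \<and> bounded S"

section \<open>Distributional derivatives\<close>

text \<open>Functions of class \<open>C\<^sup>k\<close> on the whole space, by recursion on directional derivatives.\<close>

fun Ck :: "nat \<Rightarrow> ('e::euclidean_space \<Rightarrow> complex) \<Rightarrow> bool" where
  "Ck 0 \<phi> \<longleftrightarrow> continuous_on UNIV \<phi>"
| "Ck (Suc k) \<phi> \<longleftrightarrow>
     (\<forall>x. \<phi> differentiable (at x)) \<and> (\<forall>v. Ck k (\<lambda>x. frechet_derivative \<phi> (at x) v))"

definition test_function :: "'e::euclidean_space set \<Rightarrow> ('e \<Rightarrow> complex) \<Rightarrow> bool" where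
  "test_function S \<phi> \<longleftrightarrow>
     (\<forall>k. Ck k \<phi>) \<and> compact (closure {x. \<phi> x \<noteq> 0}) \<and> closure {x. \<phi> x \<noteq> 0} \<subseteq> S"

text \<open>
  A complex coordinate direction of the underlying real space is given by the inclusion
  \<open>L\<close> of the corresponding coordinate axis; \<open>L 1\<close> and \<open>L \<i>\<close> are the directions
  of its real and imaginary parts.
\<close>

definition dbar_at :: "(complex \<Rightarrow> 'e::euclidean_space) \<Rightarrow> ('e \<Rightarrow> complex) \<Rightarrow> 'e \<Rightarrow> complex" where
  "dbar_at L \<phi> x =
     (frechet_derivative \<phi> (at x) (L 1) + \<i> * frechet_derivative \<phi> (at x) (L \<i>)) / 2"

text \<open>The coordinates \<open>z\<^sup>1\<^sub>m\<close> (index \<open>Inl m\<close>) and \<open>z\<^sup>2\<^sub>m\<close> (index \<open>Inr m\<close>) of a product.\<close>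

fun prod_axis :: "'a + 'b \<Rightarrow> complex \<Rightarrow> (complex ^ 'a) \<times> (complex ^ 'b)" where
  "prod_axis (Inl m) c = (axis m c, 0)"
| "prod_axis (Inr m) c = (0, axis m c)"

definition locally_integrable :: "'e::euclidean_space set \<Rightarrow> ('e \<Rightarrow> complex) \<Rightarrow> bool" where
  "locally_integrable S g \<longleftrightarrow> (\<forall>K. compact K \<and> K \<subseteq> S \<longrightarrow> integrable (lebesgue_on K) g)"

text \<open>\<open>weak_dbar L S g h\<close>: the distributional barred derivative of \<open>g\<close> on \<open>S\<close>
  in the coordinate \<open>L\<close> is \<open>h\<close>.\<close>

definition weak_dbar ::
  "(complex \<Rightarrow> 'e::euclidean_space) \<Rightarrow> 'e set \<Rightarrow> ('e \<Rightarrow> complex) \<Rightarrow> ('e \<Rightarrow> complex) \<Rightarrow> bool" where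
  "weak_dbar L S g h \<longleftrightarrow>
     locally_integrable S g \<and> locally_integrable S h \<and>
     (\<forall>\<phi>. test_function S \<phi> \<longrightarrow>
        (LINT x|lebesgue_on S. g x * dbar_at L \<phi> x) = - (LINT x|lebesgue_on S. h x * \<phi> x))"

text \<open>A (0,1)-form is the family of its coefficient functions, indexed by the coordinates.\<close>

type_synonym ('i, 'e) form01 = "'i \<Rightarrow> 'e \<Rightarrow> complex"

definition dbar_closed ::
  "('i \<Rightarrow> complex \<Rightarrow> 'e::euclidean_space) \<Rightarrow> 'e set \<Rightarrow> ('i, 'e) form01 \<Rightarrow> bool" where
  "dbar_closed L S f \<longleftrightarrow>
     (\<forall>i. locally_integrable S (f i)) \<and>
     (\<forall>i j \<phi>. test_function S \<phi> \<longrightarrow>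
        (LINT x|lebesgue_on S. f i x * dbar_at (L j) \<phi> x) =
        (LINT x|lebesgue_on S. f j x * dbar_at (L i) \<phi> x))"

definition dbar_solution ::
  "('i \<Rightarrow> complex \<Rightarrow> 'e::euclidean_space) \<Rightarrow> 'e set \<Rightarrow> ('e \<Rightarrow> complex) \<Rightarrow> ('i, 'e) form01 \<Rightarrow> bool" where
  "dbar_solution L S u f \<longleftrightarrow> (\<forall>i. weak_dbar (L i) S u (f i))"

section \<open>Norms\<close>

text \<open>
  All norms take values in the extended nonnegative reals; a function belongs to the
  space in question iff its norm is finite.
\<close>

definition Linf_norm :: "'e::euclidean_space set \<Rightarrow> ('e \<Rightarrow> complex) \<Rightarrow> ennreal" where
  "Linf_norm S g =
     (if g \<in> borel_measurable (lebesgue_on S)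
      then esssup (lebesgue_on S) (\<lambda>x. ennreal (norm (g x))) else \<infinity>)"

definition Linf_form_norm :: "'e::euclidean_space set \<Rightarrow> ('i::finite, 'e) form01 \<Rightarrow> ennreal" where
  "Linf_form_norm S \<beta> = (\<Sum>i\<in>UNIV. Linf_norm S (\<beta> i))"

definition Holder_norm :: "real \<Rightarrow> 'e::euclidean_space set \<Rightarrow> ('e \<Rightarrow> complex) \<Rightarrow> ennreal" where
  "Holder_norm \<beta> S g = Linf_norm S g +
     (SUP z\<in>S. SUP w\<in>S - {z}. ennreal (norm (g z - g w) / norm (z - w) powr \<beta>))"

definition iterated_Holder_norm ::
  "real \<Rightarrow> real \<Rightarrow> 'e::euclidean_space set \<Rightarrow> 'f::euclidean_space set \<Rightarrow> ('e \<times> 'f \<Rightarrow> complex) \<Rightarrow> ennreal" where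
  "iterated_Holder_norm \<alpha>1 \<alpha>2 D1 D2 g = Linf_norm (D1 \<times> D2) g +
     (SUP z1\<in>D1. SUP w1\<in>D1 - {z1}. SUP z2\<in>D2. SUP w2\<in>D2 - {z2}.
        ennreal (norm (g (z1, z2) - g (w1, z2) - g (z1, w2) + g (w1, w2)) /
                 (norm (z1 - w1) powr \<alpha>1 * norm (z2 - w2) powr \<alpha>2)))"

definition Linf_Holder_norm ::
  "real \<Rightarrow> 'e::euclidean_space set \<Rightarrow> 'f::euclidean_space set \<Rightarrow> ('e \<times> 'f \<Rightarrow> complex) \<Rightarrow> ennreal" where
  "Linf_Holder_norm \<alpha>2 D1 D2 g = Linf_norm (D1 \<times> D2) g +
     (SUP z2\<in>D2. SUP w2\<in>D2 - {z2}.
        Linf_norm D1 (\<lambda>z1. g (z1, z2) - g (z1, w2)) / ennreal (norm (z2 - w2) powr \<alpha>2))"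

definition Holder_Linf_norm ::
  "real \<Rightarrow> 'e::euclidean_space set \<Rightarrow> 'f::euclidean_space set \<Rightarrow> ('e \<times> 'f \<Rightarrow> complex) \<Rightarrow> ennreal" where
  "Holder_Linf_norm \<alpha>1 D1 D2 g = Linf_norm (D1 \<times> D2) g +
     (SUP z1\<in>D1. SUP w1\<in>D1 - {z1}.
        Linf_norm D2 (\<lambda>z2. g (z1, z2) - g (w1, z2)) / ennreal (norm (z1 - w1) powr \<alpha>1))"

section \<open>Solution operators\<close>

text \<open>
  Operators act on representatives. Linearity together with the bound forces
  almost everywhere equal forms to have the same image on \<open>S\<close>, so such an operator is
  one on equivalence classes; its values on forms outside \<open>L\<^sup>\<infinity>\<close> are irrelevant.
\<close>

definition bounded_operator_Linf_Holder ::
  "real \<Rightarrow> 'e::euclidean_space set \<Rightarrow> (('i::finite, 'e) form01 \<Rightarrow> 'e \<Rightarrow> complex) \<Rightarrow> bool" where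
  "bounded_operator_Linf_Holder \<alpha> S T \<longleftrightarrow>
     (\<forall>\<beta> \<gamma>. Linf_form_norm S \<beta> < \<infinity> \<and> Linf_form_norm S \<gamma> < \<infinity> \<longrightarrow>
        (\<forall>z\<in>S. T (\<lambda>i x. \<beta> i x + \<gamma> i x) z = T \<beta> z + T \<gamma> z)) \<and>
     (\<forall>c \<beta>. Linf_form_norm S \<beta> < \<infinity> \<longrightarrow> (\<forall>z\<in>S. T (\<lambda>i x. c * \<beta> i x) z = c * T \<beta> z)) \<and>
     (\<exists>C::real. \<forall>\<beta>. Linf_form_norm S \<beta> < \<infinity> \<longrightarrow>
        Holder_norm \<alpha> S (T \<beta>) \<le> ennreal C * Linf_form_norm S \<beta>)"

definition solves_dbar ::
  "('i::finite \<Rightarrow> complex \<Rightarrow> 'e::euclidean_space) \<Rightarrow> 'e set \<Rightarrow> (('i, 'e) form01 \<Rightarrow> 'e \<Rightarrow> complex) \<Rightarrow> bool" where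
  "solves_dbar L S T \<longleftrightarrow>
     (\<forall>\<beta>. Linf_form_norm S \<beta> < \<infinity> \<and> dbar_closed L S \<beta> \<longrightarrow> dbar_solution L S (T \<beta>) \<beta>)"

text \<open>Action on forms with coefficients on the product, the other variables being parameters.\<close>

definition act1 ::
  "(('i, 'e) form01 \<Rightarrow> 'e \<Rightarrow> complex) \<Rightarrow> ('i, 'e \<times> 'f) form01 \<Rightarrow> 'e \<times> 'f \<Rightarrow> complex" where
  "act1 T g = (\<lambda>(z1, z2). T (\<lambda>m \<zeta>. g m (\<zeta>, z2)) z1)"

definition act2 ::
  "(('i, 'f) form01 \<Rightarrow> 'f \<Rightarrow> complex) \<Rightarrow> ('i, 'e \<times> 'f) form01 \<Rightarrow> 'e \<times> 'f \<Rightarrow> complex" where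
  "act2 T g = (\<lambda>(z1, z2). T (\<lambda>m \<zeta>. g m (z1, \<zeta>)) z2)"

text \<open>
  Since \<open>weak_dbar\<close> asks for local integrability, commutation includes that the
  functions obtained by letting the operator act slicewise are distributions on the product.
\<close>

definition commutes_dbar ::
  "(complex \<Rightarrow> 'e::euclidean_space) \<Rightarrow> 'e set \<Rightarrow> (('i::finite, 'e) form01 \<Rightarrow> 'e \<Rightarrow> complex) \<Rightarrow> bool" where
  "commutes_dbar L S A \<longleftrightarrow>
     (\<forall>g h. Linf_form_norm S g < \<infinity> \<and> Linf_form_norm S h < \<infinity> \<and>
        (\<forall>m. weak_dbar L S (g m) (h m)) \<longrightarrow> weak_dbar L S (A g) (A h))"

end

(*
  The solution is u = v + T2 G with v = T1 f_1 and G = f_2 - T1 f_12, the operators acting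
  slicewise. Hoelder continuity of f_1 in z2 and of G in z1, with values in L^oo of the other
  factor, makes every slice (not just almost every one) closed, so T1 and T2 solve the slice
  equations; it also gives the mixed difference bounds by linearity of T1 and T2.
  Commutation gives dbar_2 v = T1 f_12, hence dbar_2 u = f_2. Symmetry of second derivatives
  gives dbar_1 (T1 f_12) = dbar_1 (dbar_2 v) = dbar_2 f_1 = f_12 in the sense of distributions,
  so dbar_1 G = 0, and by commutation dbar_1 (T2 G) = T2 0 = 0, hence dbar_1 u = f_1.
*)
theory Submission
  imports Defs
begin

section \<open>Smooth functions\<close>

text \<open>The shape of \<open>u\<close> comes from a correction: \<open>v\<close> already has the
  right derivative in the first variables, and \<open>G\<close> is exactly its error in the second
  ones. Since \<open>G\<close> is holomorphic in z1 in the weak sense, adding T2 G repairs dbar_2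
  without disturbing dbar_1; expanded, u = T1 f_1 + T2 f_2 - T2 T1 f_12. The obstacle is the gap
  between every slice and almost every slice. T1 and T2 act on functions, one slice at a time, while
  an L^oo bound on the product says nothing about an individual slice. For f_1 and G the Hoelder
  condition in the parameter closes the gap. The mixed coefficients f_12 have no continuity in
  either variable, so T1 f_12 is treated differently: f_12 is replaced by a Borel function bounded
  at every point, the joint measurability of T1 f_12 is read off from commutation, and its
  derivatives are computed on the product by distributions instead of slice by slice. Its Hoelder
  continuity in z1 is a gain due to T1 alone, and it is this gain that places G in the space where
  the slice argument works for T2.\<close>

lemma Ck_Suc_imp_Ck: "Ck (Suc k) \<phi> \<Longrightarrow> Ck k \<phi>"
proof (induction k arbitrary: \<phi>)
  case 0
  then show ?case
    by (simp add: differentiable_imp_continuous_within continuous_on_eq_continuous_within)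
next
  case (Suc k)
  then show ?case by (metis Ck.simps(2))
qed

lemma Ck_const: "Ck k (\<lambda>_. c)"
  by (induction k arbitrary: c) (auto simp: frechet_derivative_const)

lemma Ck_add: "Ck k f \<Longrightarrow> Ck k g \<Longrightarrow> Ck k (\<lambda>x. f x + g x)"
proof (induction k arbitrary: f g)
  case 0
  then show ?case by (auto intro: continuous_intros)
next
  case (Suc k)
  then have "frechet_derivative (\<lambda>x. f x + g x) (at x) =
      (\<lambda>v. frechet_derivative f (at x) v + frechet_derivative g (at x) v)" for x
    by (intro frechet_derivative_at[symmetric] has_derivative_add)
       (auto simp: frechet_derivative_works[symmetric])
  then show ?case using Suc by (auto intro: differentiable_add)
qed

lemma Ck_mult: "Ck k f \<Longrightarrow> Ck k g \<Longrightarrow> Ck k (\<lambda>x. f x * g x)"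
proof (induction k arbitrary: f g)
  case 0
  then show ?case by (auto intro: continuous_intros)
next
  case (Suc k)
  then have "frechet_derivative (\<lambda>x. f x * g x) (at x) =
      (\<lambda>v. f x * frechet_derivative g (at x) v + frechet_derivative f (at x) v * g x)" for x
    by (intro frechet_derivative_at[symmetric] has_derivative_mult)
       (auto simp: frechet_derivative_works[symmetric])
  \<comment> \<open>Each term of the product rule keeps one undifferentiated factor, so the
    induction needs the factors themselves at order \<open>k\<close>, not only their
    derivatives.\<close>
  moreover have "Ck k f" "Ck k g"
    using Suc.prems Ck_Suc_imp_Ck by auto
  ultimately show ?case using Suc by (auto intro!: differentiable_mult Ck_add)
qed

lemma frechet_derivative_compose_affine:
  assumes "bounded_linear A" "f differentiable (at (A x + c))"
  shows "((\<lambda>x. f (A x + c)) has_derivative (\<lambda>v. frechet_derivative f (at (A x + c)) (A v))) (at x)"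
proof -
  have "((\<lambda>x. A x + c) has_derivative A) (at x)"
    using has_derivative_add_const[OF bounded_linear_imp_has_derivative[OF assms(1)]] .
  from diff_chain_at[OF this] assms(2) show ?thesis
    unfolding frechet_derivative_works by (auto simp: o_def)
qed

text \<open>The chain rule has a constant inner derivative, so differentiation in direction
  \<open>v\<close> becomes differentiation of \<open>f\<close> in direction \<open>A v\<close> and
  the induction closes. The instances are the inclusion of a slice, the two projections and the
  exchange of factors.\<close>

lemma Ck_compose_affine:
  assumes A: "bounded_linear A"
  shows "Ck k f \<Longrightarrow> Ck k (\<lambda>x. f (A x + c))"
proof (induction k arbitrary: f)
  case 0
  then show ?case
    by (auto intro!: continuous_intros continuous_on_compose2[of UNIV f]
        linear_continuous_on[OF A])
next
  case (Suc k)
  have d: "((\<lambda>x. f (A x + c)) has_derivative (\<lambda>v. frechet_derivative f (at (A x + c)) (A v))) (at x)" for x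
    using Suc.prems by (intro frechet_derivative_compose_affine A) auto
  then have "frechet_derivative (\<lambda>x. f (A x + c)) (at x) =
      (\<lambda>v. frechet_derivative f (at (A x + c)) (A v))" for x
    by (intro frechet_derivative_at[symmetric])
  then show ?case using Suc d unfolding Ck.simps differentiable_def
    by (auto intro: Suc)
qed

text \<open>The family is closed under differentiation, so smoothness of a bump function can be proved
  by induction for all \<open>k\<close> at once.\<close>

definition flat_exp :: "nat \<Rightarrow> real \<Rightarrow> real" where
  "flat_exp k t = (if t \<le> 0 then 0 else exp (- (1 / t)) / t ^ k)"

text \<open>With s = 1/t this is the statement that s^k / exp s tends to 0 at infinity.\<close>

lemma flat_exp_at_right_0: "(flat_exp k \<longlongrightarrow> 0) (at_right 0)"
proof -
  have "((\<lambda>t. exp (- (1 / t)) / t ^ k) \<longlongrightarrow> 0) (at_right (0::real))"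
  proof -
    have "((\<lambda>s. s ^ k / exp s) \<longlongrightarrow> (0::real)) at_top"
      by (rule tendsto_power_div_exp_0)
    from filterlim_compose[OF this filterlim_inverse_at_top_right]
    have "((\<lambda>t. inverse t ^ k / exp (inverse t)) \<longlongrightarrow> (0::real)) (at_right 0)" .
    then show ?thesis
      by (simp add: exp_minus field_simps power_one_over)
  qed
  then show ?thesis
    by (rule Lim_transform_eventually)
       (auto simp: flat_exp_def eventually_at_filter)
qed

lemma flat_exp_has_derivative:
  "(flat_exp k has_real_derivative (flat_exp (k + 2) t - real k * flat_exp (k + 1) t)) (at t)"
proof -
  consider "t < 0" | "t = 0" | "t > 0" by linarith
  then show ?thesis
  proof cases
    case 1
    have "((\<lambda>_. 0) has_real_derivative 0) (at t)" by simp
    then have "(flat_exp k has_real_derivative 0) (at t)"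
      by (rule has_field_derivative_transform_within_open[where S="{..<0}"])
         (use 1 in \<open>auto simp: flat_exp_def\<close>)
    then show ?thesis using 1 by (simp add: flat_exp_def)
  next
    case 2
    have "((\<lambda>s. (flat_exp k s - flat_exp k 0) / (s - 0)) \<longlongrightarrow> 0) (at_left 0)"
      by (rule Lim_transform_eventually[OF tendsto_const])
         (auto simp: flat_exp_def eventually_at_filter)
    \<comment> \<open>To the right of 0 the difference quotient is exactly
      \<open>flat_exp (k + 1)\<close>, so the limit just proved applies with the exponent raised by
      one.\<close>
    moreover have "((\<lambda>s. (flat_exp k s - flat_exp k 0) / (s - 0)) \<longlongrightarrow> 0) (at_right 0)"
      by (rule Lim_transform_eventually[OF flat_exp_at_right_0[of "k + 1"]])
         (auto simp: flat_exp_def eventually_at_filter)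
    ultimately have "(flat_exp k has_real_derivative 0) (at 0)"
      unfolding has_field_derivative_iff by (rule filterlim_split_at)
    then show ?thesis using 2 by (simp add: flat_exp_def)
  next
    case 3
    have "((\<lambda>s. exp (- (1 / s)) / s ^ k) has_real_derivative
        (exp (- (1 / t)) / t ^ (k + 2) - real k * (exp (- (1 / t)) / t ^ (k + 1)))) (at t)"
    proof -
      have "((\<lambda>s. s ^ k) has_real_derivative real k * t ^ k / t) (at t)"
      proof (cases k)
        case (Suc m)
        then show ?thesis using DERIV_pow[of k t] 3 by simp
      qed simp
      moreover have "((\<lambda>s. exp (- (1 / s))) has_real_derivative exp (- (1 / t)) / t\<^sup>2) (at t)"
        using 3 by (auto intro!: derivative_eq_intros simp: power2_eq_square)
      ultimately have "((\<lambda>s. exp (- (1 / s)) / s ^ k) has_real_derivative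
          (exp (- (1 / t)) / t\<^sup>2 * t ^ k - exp (- (1 / t)) * (real k * t ^ k / t)) / (t ^ k * t ^ k)) (at t)"
        using 3 by (intro DERIV_divide) auto
      then show ?thesis
        by (rule DERIV_cong) (use 3 in \<open>simp add: field_simps power2_eq_square\<close>)
    qed
    then have "(flat_exp k has_real_derivative
        (exp (- (1 / t)) / t ^ (k + 2) - real k * (exp (- (1 / t)) / t ^ (k + 1)))) (at t)"
      by (rule has_field_derivative_transform_within_open[where S="{0<..}"])
         (use 3 in \<open>auto simp: flat_exp_def\<close>)
    then show ?thesis using 3 by (simp add: flat_exp_def)
  qed
qed

text \<open>The derivative is constant in \<open>x\<close>, so class \<open>Suc k\<close> is
  immediate from \<open>Ck_const\<close> and class \<open>k\<close> follows by descent.\<close>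

lemma Ck_of_real_linear:
  assumes "bounded_linear l"
  shows "Ck k (\<lambda>x. complex_of_real (l x + c))"
proof -
  have d: "((\<lambda>x. complex_of_real (l x + c)) has_derivative (\<lambda>v. complex_of_real (l v))) (at x)" for x
    by (rule derivative_eq_intros bounded_linear_imp_has_derivative[OF assms] | simp)+
  have "frechet_derivative (\<lambda>x. complex_of_real (l x + c)) (at x) = (\<lambda>v. complex_of_real (l v))" for x
    by (rule frechet_derivative_at[OF d, symmetric])
  then have "Ck (Suc k) (\<lambda>x. complex_of_real (l x + c))"
    using d by (auto simp: Ck_const differentiable_def)
  then show ?thesis by (rule Ck_Suc_imp_Ck)
qed

text \<open>A bump that is positive exactly on the ball of radius |r| about \<open>c\<close>. Its
  derivatives are members of the same family with exponents \<open>k + 1\<close> and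
  \<open>k + 2\<close>, times affine factors; hence the induction on \<open>n\<close> keeps
  \<open>k\<close> arbitrary.\<close>

lemma Ck_flat_exp_ball:
  fixes c :: "'e::euclidean_space"
  shows "Ck n (\<lambda>x. complex_of_real (flat_exp k (r\<^sup>2 - (x - c) \<bullet> (x - c))))"
proof (induction n arbitrary: k)
  case 0
  have "continuous_on UNIV (flat_exp k)"
    using flat_exp_has_derivative DERIV_isCont continuous_at_imp_continuous_on by blast
  then show ?case
    by (auto intro!: continuous_intros continuous_on_compose2[of UNIV "flat_exp k"])
next
  case (Suc n)
  define q where "q x = r\<^sup>2 - (x - c) \<bullet> (x - c)" for x
  have q: "(q has_derivative (\<lambda>v. - 2 * ((x - c) \<bullet> v))) (at x)" for x
    unfolding q_def
    by (auto intro!: derivative_eq_intros simp: inner_commute algebra_simps)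
  \<comment> \<open>The inner derivative -2 (x - c).v is split into a linear part and a constant to
    fit \<open>Ck_of_real_linear\<close>.\<close>
  have d: "((\<lambda>x. complex_of_real (flat_exp k (q x))) has_derivative
     (\<lambda>v. (complex_of_real (flat_exp (k + 2) (q x)) + (- of_nat k) * complex_of_real (flat_exp (k + 1) (q x)))
        * complex_of_real (- 2 * (x \<bullet> v) + 2 * (c \<bullet> v)))) (at x)" for x
  proof -
    have 1: "(flat_exp k has_derivative (\<lambda>h. (flat_exp (k + 2) (q x) - real k * flat_exp (k + 1) (q x)) * h)) (at (q x))"
      using flat_exp_has_derivative[of k "q x"] unfolding has_field_derivative_def .
    have "((\<lambda>x. flat_exp k (q x)) has_derivative (\<lambda>v. (flat_exp (k + 2) (q x) - real k * flat_exp (k + 1) (q x)) * (- 2 * ((x - c) \<bullet> v)))) (at x)"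
      using diff_chain_at[OF q[of x] 1] unfolding o_def .
    from has_derivative_of_real[OF this] show ?thesis
      by (rule has_derivative_eq_rhs) (auto simp: inner_diff_left algebra_simps)
  qed
  have "frechet_derivative (\<lambda>x. complex_of_real (flat_exp k (q x))) (at x) =
     (\<lambda>v. (complex_of_real (flat_exp (k + 2) (q x)) + (- of_nat k) * complex_of_real (flat_exp (k + 1) (q x)))
        * complex_of_real (- 2 * (x \<bullet> v) + 2 * (c \<bullet> v)))" for x
    by (rule frechet_derivative_at[OF d, symmetric])
  moreover have "Ck n (\<lambda>x. (complex_of_real (flat_exp (k + 2) (q x)) + (- of_nat k) * complex_of_real (flat_exp (k + 1) (q x)))
        * complex_of_real (- 2 * (x \<bullet> v) + 2 * (c \<bullet> v)))" for v
    unfolding q_def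
    by (intro Ck_mult Ck_add Suc.IH Ck_const Ck_of_real_linear
        bounded_linear_const_mult bounded_linear_inner_left)
  ultimately show ?case
    using d unfolding q_def[symmetric] by (auto simp: differentiable_def)
qed

section \<open>Symmetry of second derivatives\<close>

text \<open>Schwarz's theorem by second differences: the second difference over a small
  parallelogram is symmetric in the two directions, and two uses of the mean value theorem express
  it through either mixed derivative at a nearby point. Values are real because the mean value
  theorem is applied.\<close>

lemma mixed_directional_derivatives_eq:
  fixes f :: "'e::real_normed_vector \<Rightarrow> real"
  assumes fv: "\<And>x s. ((\<lambda>s. f (x + s *\<^sub>R v)) has_real_derivative fv (x + s *\<^sub>R v)) (at s)"
    and fw: "\<And>x s. ((\<lambda>s. f (x + s *\<^sub>R w)) has_real_derivative fw (x + s *\<^sub>R w)) (at s)"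
    and fvw: "\<And>x s. ((\<lambda>s. fv (x + s *\<^sub>R w)) has_real_derivative fvw (x + s *\<^sub>R w)) (at s)"
    and fwv: "\<And>x s. ((\<lambda>s. fw (x + s *\<^sub>R v)) has_real_derivative fwv (x + s *\<^sub>R v)) (at s)"
    and cont: "isCont fvw x" "isCont fwv x"
  shows "fvw x = fwv x"
proof -
  \<comment> \<open>Stated for an arbitrary pair of directions so that it serves both orders of
    differentiation. The mean value theorem is used along \<open>a\<close> for the difference of two
    parallel lines, then along \<open>b\<close>.\<close>
  have key: "\<exists>\<xi> \<eta>. 0 < \<xi> \<and> \<xi> < h \<and> 0 < \<eta> \<and> \<eta> < h \<and>
      f (x + h *\<^sub>R a + h *\<^sub>R b) - f (x + h *\<^sub>R a) - f (x + h *\<^sub>R b) + f x = h * (h * g (x + \<xi> *\<^sub>R a + \<eta> *\<^sub>R b))"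
    if h: "h > 0"
      and fa: "\<And>x s. ((\<lambda>s. f (x + s *\<^sub>R a)) has_real_derivative fa (x + s *\<^sub>R a)) (at s)"
      and g: "\<And>x s. ((\<lambda>s. fa (x + s *\<^sub>R b)) has_real_derivative g (x + s *\<^sub>R b)) (at s)"
    for a b h fa g
  proof -
    have 1: "((\<lambda>s. f (x + h *\<^sub>R b + s *\<^sub>R a) - f (x + s *\<^sub>R a)) has_real_derivative
        (fa (x + h *\<^sub>R b + s *\<^sub>R a) - fa (x + s *\<^sub>R a))) (at s)" for s
      by (intro DERIV_diff fa)
    obtain \<xi> where \<xi>: "0 < \<xi>" "\<xi> < h"
      "(f (x + h *\<^sub>R b + h *\<^sub>R a) - f (x + h *\<^sub>R a)) - (f (x + h *\<^sub>R b + 0 *\<^sub>R a) - f (x + 0 *\<^sub>R a))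
        = (h - 0) * (fa (x + h *\<^sub>R b + \<xi> *\<^sub>R a) - fa (x + \<xi> *\<^sub>R a))"
      using MVT2[OF h 1] by blast
    obtain \<eta> where \<eta>: "0 < \<eta>" "\<eta> < h"
      "fa (x + \<xi> *\<^sub>R a + h *\<^sub>R b) - fa (x + \<xi> *\<^sub>R a + 0 *\<^sub>R b) = (h - 0) * g (x + \<xi> *\<^sub>R a + \<eta> *\<^sub>R b)"
      using MVT2[OF h g[of "x + \<xi> *\<^sub>R a"]] by blast
    show ?thesis
      using \<xi> \<eta> by (intro exI[of _ \<xi>] exI[of _ \<eta>]) (auto simp: algebra_simps)
  qed
  define h where "h n = 1 / real (Suc n)" for n
  have h: "h n > 0" for n by (simp add: h_def)
  have h0: "h \<longlonglongrightarrow> 0" unfolding h_def using LIMSEQ_inverse_real_of_nat by (simp add: inverse_eq_divide)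
  obtain s t where st: "\<And>n. 0 < s n \<and> s n < h n \<and> 0 < t n \<and> t n < h n \<and>
      f (x + h n *\<^sub>R v + h n *\<^sub>R w) - f (x + h n *\<^sub>R v) - f (x + h n *\<^sub>R w) + f x = h n * (h n * fvw (x + s n *\<^sub>R v + t n *\<^sub>R w))"
    using key[OF h fv fvw] by metis
  obtain s' t' where st': "\<And>n. 0 < s' n \<and> s' n < h n \<and> 0 < t' n \<and> t' n < h n \<and>
      f (x + h n *\<^sub>R w + h n *\<^sub>R v) - f (x + h n *\<^sub>R w) - f (x + h n *\<^sub>R v) + f x = h n * (h n * fwv (x + s' n *\<^sub>R w + t' n *\<^sub>R v))"
    using key[OF h fw fwv] by metis
  have lim0: "r \<longlonglongrightarrow> 0" if "\<And>n. 0 < r n \<and> r n < h n" for r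
    using that by (intro tendsto_sandwich[OF _ _ tendsto_const h0]) (auto intro: always_eventually less_imp_le)
  have "s \<longlonglongrightarrow> 0" "t \<longlonglongrightarrow> 0" "s' \<longlonglongrightarrow> 0" "t' \<longlonglongrightarrow> 0"
    using st st' by (auto intro: lim0)
  then have "(\<lambda>n. x + s n *\<^sub>R v + t n *\<^sub>R w) \<longlonglongrightarrow> x + 0 *\<^sub>R v + 0 *\<^sub>R w"
    "(\<lambda>n. x + s' n *\<^sub>R w + t' n *\<^sub>R v) \<longlonglongrightarrow> x + 0 *\<^sub>R w + 0 *\<^sub>R v"
    by (auto intro!: tendsto_intros simp del: scaleR_zero_left)
  then have "(\<lambda>n. fvw (x + s n *\<^sub>R v + t n *\<^sub>R w)) \<longlonglongrightarrow> fvw x"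
    "(\<lambda>n. fwv (x + s' n *\<^sub>R w + t' n *\<^sub>R v)) \<longlonglongrightarrow> fwv x"
    using isCont_tendsto_compose[OF cont(1)] isCont_tendsto_compose[OF cont(2)] by auto
  moreover have "fvw (x + s n *\<^sub>R v + t n *\<^sub>R w) = fwv (x + s' n *\<^sub>R w + t' n *\<^sub>R v)" for n
  proof -
    have "x + h n *\<^sub>R w + h n *\<^sub>R v = x + h n *\<^sub>R v + h n *\<^sub>R w"
      by (simp add: algebra_simps)
    then have "h n * (h n * fvw (x + s n *\<^sub>R v + t n *\<^sub>R w)) = h n * (h n * fwv (x + s' n *\<^sub>R w + t' n *\<^sub>R v))"
      using st[of n] st'[of n] by (smt (verit))
    then show ?thesis using h[of n] by simp
  qed
  ultimately show ?thesis using LIMSEQ_unique by auto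
qed

lemma frechet_derivative_line:
  assumes "\<phi> differentiable (at (x + s *\<^sub>R v))"
  shows "((\<lambda>s. \<phi> (x + s *\<^sub>R v)) has_derivative (\<lambda>h. h *\<^sub>R frechet_derivative \<phi> (at (x + s *\<^sub>R v)) v)) (at s)"
proof -
  have "((\<lambda>s. x + s *\<^sub>R v) has_derivative (\<lambda>h. h *\<^sub>R v)) (at s)"
    by (auto intro!: derivative_eq_intros)
  from diff_chain_at[OF this] assms
  have "((\<lambda>s. \<phi> (x + s *\<^sub>R v)) has_derivative (\<lambda>h. frechet_derivative \<phi> (at (x + s *\<^sub>R v)) (h *\<^sub>R v))) (at s)"
    unfolding frechet_derivative_works by (auto simp: o_def)
  then show ?thesis
    using linear_frechet_derivative[OF assms] by (simp add: linear_cmul)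
qed

text \<open>Real and imaginary parts are treated separately, each as a real function with the
  directional derivatives of \<open>\<phi>\<close> composed with \<open>Re\<close> or
  \<open>Im\<close>.\<close>

lemma Ck_frechet_derivative_commute:
  fixes \<phi> :: "'e::euclidean_space \<Rightarrow> complex"
  assumes "\<And>k. Ck k \<phi>"
  shows "frechet_derivative (\<lambda>x. frechet_derivative \<phi> (at x) v) (at x) w =
         frechet_derivative (\<lambda>x. frechet_derivative \<phi> (at x) w) (at x) v"
proof -
  define d where "d v x = frechet_derivative \<phi> (at x) v" for v x
  define dd where "dd v w x = frechet_derivative (d v) (at x) w" for v w x
  have "Ck 2 \<phi>" by fact
  then have 1: "\<phi> differentiable (at x)" "d v differentiable (at x)" "continuous_on UNIV (dd v w)" for x v w
    by (auto simp: numeral_2_eq_2 d_def[abs_def] dd_def[abs_def])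
  have 2: "isCont (dd v w) x" for v w x
    using 1(3) continuous_on_eq_continuous_at open_UNIV by blast
  have 3: "((\<lambda>s. l (\<phi> (x + s *\<^sub>R v))) has_real_derivative l (d v (x + s *\<^sub>R v))) (at s)"
    "((\<lambda>s. l (d v (x + s *\<^sub>R w))) has_real_derivative l (dd v w (x + s *\<^sub>R w))) (at s)"
    if l: "bounded_linear l" for l v w s x
  proof -
    note lin = linear_cmul[OF bounded_linear.linear[OF l]]
    show "((\<lambda>s. l (\<phi> (x + s *\<^sub>R v))) has_real_derivative l (d v (x + s *\<^sub>R v))) (at s)"
      using bounded_linear.has_derivative[OF l frechet_derivative_line[OF 1(1)]]
      unfolding has_field_derivative_def d_def by (simp add: lin mult.commute[of _ "l _"])
    show "((\<lambda>s. l (d v (x + s *\<^sub>R w))) has_real_derivative l (dd v w (x + s *\<^sub>R w))) (at s)"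
      using bounded_linear.has_derivative[OF l frechet_derivative_line[OF 1(2)]]
      unfolding has_field_derivative_def dd_def by (simp add: lin mult.commute[of _ "l _"])
  qed
  have "Re (dd v w x) = Re (dd w v x)"
    by (rule mixed_directional_derivatives_eq[where f="\<lambda>x. Re (\<phi> x)" and fv="\<lambda>x. Re (d v x)" and fw="\<lambda>x. Re (d w x)" and v=v and w=w])
       (intro 3 2 bounded_linear_Re isCont_Re)+
  moreover have "Im (dd v w x) = Im (dd w v x)"
    by (rule mixed_directional_derivatives_eq[where f="\<lambda>x. Im (\<phi> x)" and fv="\<lambda>x. Im (d v x)" and fw="\<lambda>x. Im (d w x)" and v=v and w=w])
       (intro 3 2 bounded_linear_Im isCont_Im)+
  ultimately show ?thesis unfolding dd_def d_def by (rule complex_eqI)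
qed

section \<open>Lebesgue measure on products and the sup norm\<close>

lemma AE_lebesgue_on_iff:
  assumes "S \<in> sets lebesgue"
  shows "(AE x in lebesgue_on S. P x) \<longleftrightarrow> (AE x in lebesgue. x \<in> S \<longrightarrow> P x)"
  using assms by (intro AE_restrict_space_iff) auto

text \<open>A nonempty open set is not null, so a property that holds almost everywhere holds on a
  dense set. Together with a Hoelder estimate this carries bounds and measurability from almost
  every point to every point.\<close>

lemma AE_lebesgue_on_open_approx:
  fixes S :: "'e::euclidean_space set"
  assumes S: "open S" and ae: "AE x in lebesgue_on S. P x" and x: "x \<in> S"
  obtains X where "\<And>n. X n \<in> S" "\<And>n. P (X n)" "X \<longlonglongrightarrow> x"
proof -
  have "AE x\<in>S in lebesgue. x \<in> closure {y \<in> S. P y}"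
    using ae S closure_subset[of "{y \<in> S. P y}"] by (auto simp: AE_lebesgue_on_iff)
  then have "x \<in> closure {y \<in> S. P y}"
    using mem_closed_if_AE_lebesgue_open[OF S _ _ x] by blast
  then show ?thesis
    unfolding closure_sequential using that by blast
qed

text \<open>Lebesgue measure on a product is the completion of the product measure, not a product of
  the completed factors. Facts about slices and iterated integrals are therefore proved for a Borel
  function, extended by zero off \<open>S\<close>, and carried back along almost everywhere
  equality.\<close>

lemma lebesgue_on_borel_representative:
  fixes F :: "'e::euclidean_space \<Rightarrow> complex"
  assumes S: "S \<in> sets lebesgue" and F: "F \<in> borel_measurable (lebesgue_on S)"
  obtains G where "G \<in> borel_measurable borel" "AE x in lebesgue. indicator S x *\<^sub>R F x = G x"
proof -
  define f where "f x = indicator S x *\<^sub>R F x" for x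
  have f: "f \<in> borel_measurable lebesgue"
    unfolding f_def using F S by (simp add: borel_measurable_restrict_space_iff)
  obtain a where a: "a \<in> borel_measurable lborel" "AE x in lborel. Re (f x) = a x"
    using completion_ex_borel_measurable_real[of "\<lambda>x. Re (f x)" lborel] f by auto
  obtain b where b: "b \<in> borel_measurable lborel" "AE x in lborel. Im (f x) = b x"
    using completion_ex_borel_measurable_real[of "\<lambda>x. Im (f x)" lborel] f by auto
  have "(\<lambda>x. Complex (a x) (b x)) \<in> borel_measurable borel"
    using a(1) b(1) by (subst borel_measurable_complex_iff) simp
  moreover have "AE x in lebesgue. f x = Complex (a x) (b x)"
    using a(2) b(2) unfolding AE_completion_iff by eventually_elim (simp add: complex_eq_iff)
  ultimately show ?thesis using that unfolding f_def by blast
qed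

lemma AE_lebesgue_swap:
  fixes P :: "'e::euclidean_space \<times> 'f::euclidean_space \<Rightarrow> bool"
  assumes "AE z in lebesgue. P z"
  shows "AE z in lebesgue. P (prod.swap z)"
proof -
  have "AE z in distr (lborel \<Otimes>\<^sub>M lborel) (lborel \<Otimes>\<^sub>M lborel) (\<lambda>(y::'f, x::'e). (x, y)). P z"
    using assms unfolding AE_completion_iff
    by (subst lborel_pair.distr_pair_swap[symmetric]) (unfold lborel_prod)
  from AE_distrD[OF measurable_pair_swap' this]
  show ?thesis
    unfolding AE_completion_iff lborel_prod by (simp add: prod.swap_def case_prod_unfold)
qed

lemma AE_lebesgue_slice:
  fixes P :: "'e::euclidean_space \<times> 'f::euclidean_space \<Rightarrow> bool"
  assumes "AE z in lebesgue. P z"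
  shows "AE y in lebesgue. AE x in lebesgue. P (x, y)"
proof -
  have "AE z in lborel \<Otimes>\<^sub>M lborel. P (prod.swap z)"
    using AE_lebesgue_swap[OF assms] unfolding AE_completion_iff lborel_prod .
  from lborel_pair.AE_pair[OF this] show ?thesis
    unfolding AE_completion_iff by simp
qed

text \<open>All slices of the Borel representative are Borel, and for almost every \<open>y\<close>
  they agree with those of \<open>F\<close> almost everywhere. More cannot hold for \<open>F\<close>
  itself, as changing it on one slice, a null set, may destroy measurability there.\<close>

lemma measurable_lebesgue_on_slice:
  fixes F :: "'e::euclidean_space \<times> 'f::euclidean_space \<Rightarrow> complex"
  assumes S: "open S" and T: "open T" and F: "F \<in> borel_measurable (lebesgue_on (S \<times> T))"
  shows "AE y in lebesgue_on T. (\<lambda>x. F (x, y)) \<in> borel_measurable (lebesgue_on S)"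
proof -
  have ST: "S \<times> T \<in> sets lebesgue" "S \<in> sets lebesgue" "T \<in> sets lebesgue"
    using open_Times[OF S T] S T by auto
  obtain G where G: "G \<in> borel_measurable borel"
    "AE z in lebesgue. indicator (S \<times> T) z *\<^sub>R F z = G z"
    using lebesgue_on_borel_representative[OF ST(1) F] .
  have Gy: "(\<lambda>x. G (x, y)) \<in> borel_measurable lebesgue" for y
  proof -
    have "(\<lambda>x. G (x, y)) \<in> borel_measurable borel"
      using G(1) by (rule measurable_compose[rotated]) (simp add: borel_measurable_Pair)
    then show ?thesis by (simp add: measurable_completion)
  qed
  have "AE y in lebesgue. AE x in lebesgue. indicator (S \<times> T) (x, y) *\<^sub>R F (x, y) = G (x, y)"
    using AE_lebesgue_slice[OF G(2)] .
  then have "AE y in lebesgue. y \<in> T \<longrightarrow> (\<lambda>x. F (x, y)) \<in> borel_measurable (lebesgue_on S)"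
  proof eventually_elim
    case (elim y)
    show ?case
    proof
      assume "y \<in> T"
      then have "AE x in lebesgue. G (x, y) = indicator S x *\<^sub>R F (x, y)"
        using elim by (auto simp: indicator_def)
      then have "(\<lambda>x. indicator S x *\<^sub>R F (x, y)) \<in> borel_measurable lebesgue"
        by (rule borel_measurable_AE[OF Gy])
      then show "(\<lambda>x. F (x, y)) \<in> borel_measurable (lebesgue_on S)"
        using ST by (simp add: borel_measurable_restrict_space_iff)
    qed
  qed
  then show ?thesis using ST by (simp add: AE_lebesgue_on_iff)
qed

section \<open>Integration on products and exchange of the factors\<close>

lemma Fubini_lebesgue_on:
  fixes F :: "'e::euclidean_space \<times> 'f::euclidean_space \<Rightarrow> complex"
  assumes S: "open S" and T: "open T" and F: "integrable (lebesgue_on (S \<times> T)) F"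
  shows "(LINT z|lebesgue_on (S \<times> T). F z) = (LINT y|lebesgue_on T. LINT x|lebesgue_on S. F (x, y))"
proof -
  have ST: "S \<times> T \<in> sets lebesgue" "S \<in> sets lebesgue" "T \<in> sets lebesgue"
    using open_Times[OF S T] S T by auto
  obtain G where G: "G \<in> borel_measurable borel"
    "AE z in lebesgue. indicator (S \<times> T) z *\<^sub>R F z = G z"
    using lebesgue_on_borel_representative[OF ST(1) borel_measurable_integrable[OF F]] .
  have F': "integrable lebesgue (\<lambda>z. indicator (S \<times> T) z *\<^sub>R F z)"
    using F ST by (simp add: integrable_restrict_space)
  have Gl: "G \<in> borel_measurable lebesgue"
    using G(1) by (simp add: measurable_completion)
  have iG: "integrable lborel G"
    using integrable_cong_AE_imp[OF F' Gl] G(2) G(1)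
    by (simp add: integrable_completion eq_commute)
  have G_slice: "(\<lambda>x. G (x, y)) \<in> borel_measurable borel" for y
    using G(1) by (rule measurable_compose[rotated]) (simp add: borel_measurable_Pair)
  \<comment> \<open>The slice of \<open>F\<close> inherits measurability from that of
    \<open>G\<close> by completeness of Lebesgue measure; the same argument below makes the inner
    integral measurable in \<open>y\<close>.\<close>
  have inner: "AE y in lebesgue. indicator T y *\<^sub>R (LINT x|lebesgue_on S. F (x, y)) = (LINT x|lborel. G (x, y))"
    using AE_lebesgue_slice[OF G(2)]
  proof eventually_elim
    case (elim y)
    have "(LINT x|lborel. G (x, y)) = (LINT x|lebesgue. G (x, y))"
      using G_slice by (simp add: integral_completion)
    also have "\<dots> = (LINT x|lebesgue. indicator (S \<times> T) (x, y) *\<^sub>R F (x, y))"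
    proof (rule integral_cong_AE)
      show "(\<lambda>x. G (x, y)) \<in> borel_measurable lebesgue"
        using G_slice by (simp add: measurable_completion)
      then show "(\<lambda>x. indicator (S \<times> T) (x, y) *\<^sub>R F (x, y)) \<in> borel_measurable lebesgue"
        using borel_measurable_AE elim by (simp add: eq_commute)
    qed (use elim in \<open>simp add: eq_commute\<close>)
    also have "\<dots> = indicator T y *\<^sub>R (LINT x|lebesgue. indicator S x *\<^sub>R F (x, y))"
      by (simp add: indicator_times indicator_def)
    finally show ?case using ST by (simp add: integral_restrict_space)
  qed
  have mG: "(\<lambda>y. LINT x|lborel. G (x, y)) \<in> borel_measurable borel"
  proof -
    have "(\<lambda>(y, x). G (x, y)) \<in> borel_measurable (borel \<Otimes>\<^sub>M lborel)"
      using measurable_compose[OF _ G(1), of "\<lambda>(y, x). (x, y)" "borel \<Otimes>\<^sub>M lborel"]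
      by (simp add: borel_prod case_prod_unfold borel_measurable_Pair)
    then show ?thesis
      using lborel.borel_measurable_lebesgue_integral[of "\<lambda>y x. G (x, y)" borel] by simp
  qed
  have "(LINT z|lebesgue_on (S \<times> T). F z) = (LINT z|lebesgue. indicator (S \<times> T) z *\<^sub>R F z)"
    using ST by (simp add: integral_restrict_space)
  also have "\<dots> = (LINT z|lebesgue. G z)"
    by (rule integral_cong_AE) (use F' Gl G(2) in auto)
  also have "\<dots> = (LINT z|lborel. G z)"
    using G(1) by (simp add: integral_completion)
  also have "\<dots> = (LINT y|lborel. LINT x|lborel. G (x, y))"
    using lborel_pair.integral_snd[of "\<lambda>x y. G (x, y)"] iG by (simp add: lborel_prod)
  also have "\<dots> = (LINT y|lebesgue. LINT x|lborel. G (x, y))"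
    using mG by (simp add: integral_completion)
  also have "\<dots> = (LINT y|lebesgue. indicator T y *\<^sub>R (LINT x|lebesgue_on S. F (x, y)))"
  proof (rule integral_cong_AE)
    show mG': "(\<lambda>y. LINT x|lborel. G (x, y)) \<in> borel_measurable lebesgue"
      using mG by (simp add: measurable_completion)
    show "(\<lambda>y. indicator T y *\<^sub>R (LINT x|lebesgue_on S. F (x, y))) \<in> borel_measurable lebesgue"
      using borel_measurable_AE[OF mG'] inner by (simp add: eq_commute)
  qed (use inner in \<open>simp add: eq_commute\<close>)
  also have "\<dots> = (LINT y|lebesgue_on T. LINT x|lebesgue_on S. F (x, y))"
    using ST by (simp add: integral_restrict_space)
  finally show ?thesis .
qed

lemma lebesgue_on_swap_measurable:
  fixes F :: "'e::euclidean_space \<times> 'f::euclidean_space \<Rightarrow> complex"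
  assumes S: "open S" and T: "open T" and F: "F \<in> borel_measurable (lebesgue_on (S \<times> T))"
  shows "(\<lambda>z. F (prod.swap z)) \<in> borel_measurable (lebesgue_on (T \<times> S))"
proof -
  have ST: "S \<times> T \<in> sets lebesgue" "T \<times> S \<in> sets lebesgue"
    using open_Times[OF S T] open_Times[OF T S] by auto
  obtain G where G: "G \<in> borel_measurable borel"
    "AE z in lebesgue. indicator (S \<times> T) z *\<^sub>R F z = G z"
    using lebesgue_on_borel_representative[OF ST(1) F] .
  have ind: "(indicator (S \<times> T) (prod.swap z) :: real) = indicator (T \<times> S) z" for z
    by (cases z) (auto simp: indicator_def)
  have 1: "AE z in lebesgue. G (prod.swap z) = indicator (T \<times> S) z *\<^sub>R F (prod.swap z)"
    using AE_lebesgue_swap[OF G(2)] by eventually_elim (simp add: ind)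
  have "(\<lambda>z. G (prod.swap z)) \<in> borel_measurable borel"
    using G(1) by (rule measurable_compose[rotated])
      (simp add: borel_measurable_Pair prod.swap_def borel_prod[symmetric])
  then have "(\<lambda>z. G (prod.swap z)) \<in> borel_measurable lebesgue"
    by (simp add: measurable_completion)
  from borel_measurable_AE[OF this 1] show ?thesis
    using ST by (simp add: borel_measurable_restrict_space_iff)
qed

lemma lebesgue_on_swap_integral:
  fixes F :: "'e::euclidean_space \<times> 'f::euclidean_space \<Rightarrow> complex"
  assumes S: "open S" and T: "open T" and F: "F \<in> borel_measurable (lebesgue_on (S \<times> T))"
  shows "(LINT z|lebesgue_on (T \<times> S). F (prod.swap z)) = (LINT z|lebesgue_on (S \<times> T). F z)"
proof -
  have ST: "S \<times> T \<in> sets lebesgue" "T \<times> S \<in> sets lebesgue"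
    using open_Times[OF S T] open_Times[OF T S] by auto
  obtain G where G: "G \<in> borel_measurable borel"
    "AE z in lebesgue. indicator (S \<times> T) z *\<^sub>R F z = G z"
    using lebesgue_on_borel_representative[OF ST(1) F] .
  have ind: "(indicator (S \<times> T) (prod.swap z) :: real) = indicator (T \<times> S) z" for z
    by (cases z) (auto simp: indicator_def)
  have 1: "AE z in lebesgue. G (prod.swap z) = indicator (T \<times> S) z *\<^sub>R F (prod.swap z)"
    using AE_lebesgue_swap[OF G(2)] by eventually_elim (simp add: ind)
  have sw: "(\<lambda>z. G (prod.swap z)) \<in> borel_measurable borel"
    using G(1) by (rule measurable_compose[rotated])
      (simp add: borel_measurable_Pair prod.swap_def borel_prod[symmetric])
  then have sw': "(\<lambda>z. G (prod.swap z)) \<in> borel_measurable lebesgue"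
    by (simp add: measurable_completion)
  have "(LINT z|lebesgue_on (T \<times> S). F (prod.swap z)) = (LINT z|lebesgue. indicator (T \<times> S) z *\<^sub>R F (prod.swap z))"
    using ST by (simp add: integral_restrict_space)
  also have "\<dots> = (LINT z|lebesgue. G (prod.swap z))"
    by (rule integral_cong_AE) (use 1 sw' borel_measurable_AE[OF sw' 1] in \<open>auto simp: eq_commute\<close>)
  also have "\<dots> = (LINT z|lborel. G (prod.swap z))"
    using sw by (simp add: integral_completion)
  also have "\<dots> = (LINT z|lborel. G z)"
    using lborel_pair.integral_product_swap[of G] G(1)
    by (simp add: lborel_prod prod.swap_def case_prod_unfold)
  also have "\<dots> = (LINT z|lebesgue. G z)"
    using G(1) by (simp add: integral_completion)
  also have "\<dots> = (LINT z|lebesgue. indicator (S \<times> T) z *\<^sub>R F z)"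
    by (rule integral_cong_AE)
       (use G F ST in \<open>auto simp: borel_measurable_restrict_space_iff measurable_completion eq_commute\<close>)
  also have "\<dots> = (LINT z|lebesgue_on (S \<times> T). F z)"
    using ST by (simp add: integral_restrict_space)
  finally show ?thesis .
qed

lemma AE_lebesgue_on_swap:
  fixes P :: "'e::euclidean_space \<times> 'f::euclidean_space \<Rightarrow> bool"
  assumes S: "open S" and T: "open T" and ae: "AE z in lebesgue_on (S \<times> T). P z"
  shows "AE z in lebesgue_on (T \<times> S). P (prod.swap z)"
proof -
  have ST: "S \<times> T \<in> sets lebesgue" "T \<times> S \<in> sets lebesgue"
    using open_Times[OF S T] open_Times[OF T S] by auto
  have "AE z in lebesgue. z \<in> S \<times> T \<longrightarrow> P z"
    using ae ST by (simp add: AE_lebesgue_on_iff)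
  from AE_lebesgue_swap[OF this] show ?thesis
    using ST by (simp add: AE_lebesgue_on_iff case_prod_unfold mem_Times_iff conj_commute)
qed

lemma AE_lebesgue_on_slice:
  fixes P :: "'e::euclidean_space \<times> 'f::euclidean_space \<Rightarrow> bool"
  assumes S: "open S" and T: "open T" and ae: "AE z in lebesgue_on (S \<times> T). P z"
  shows "AE y in lebesgue_on T. AE x in lebesgue_on S. P (x, y)"
proof -
  have ST: "S \<times> T \<in> sets lebesgue" "S \<in> sets lebesgue" "T \<in> sets lebesgue"
    using open_Times[OF S T] S T by auto
  have "AE z in lebesgue. z \<in> S \<times> T \<longrightarrow> P z"
    using ae ST by (simp add: AE_lebesgue_on_iff)
  from AE_lebesgue_slice[OF this]
  have "AE y in lebesgue. y \<in> T \<longrightarrow> (AE x in lebesgue_on S. P (x, y))"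
    by eventually_elim (use ST in \<open>auto simp: AE_lebesgue_on_iff\<close>)
  then show ?thesis
    using ST by (simp add: AE_lebesgue_on_iff)
qed

section \<open>The essential supremum norm\<close>

text \<open>Measurability is part of the equivalence because a nonmeasurable function has norm
  \<open>\<infinity>\<close>. The later estimates are carried out with real bounds through this
  form.\<close>

lemma Linf_norm_le_iff:
  assumes "M \<ge> 0"
  shows "Linf_norm S g \<le> ennreal M \<longleftrightarrow>
    g \<in> borel_measurable (lebesgue_on S) \<and> (AE x in lebesgue_on S. norm (g x) \<le> M)"
proof -
  let ?h = "\<lambda>x. ennreal (norm (g x))"
  have "esssup (lebesgue_on S) ?h \<le> ennreal M \<longleftrightarrow> (AE x in lebesgue_on S. norm (g x) \<le> M)"
    if g: "g \<in> borel_measurable (lebesgue_on S)"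
  proof
    assume *: "esssup (lebesgue_on S) ?h \<le> ennreal M"
    show "AE x in lebesgue_on S. norm (g x) \<le> M"
      using esssup_AE[of ?h "lebesgue_on S"]
    proof eventually_elim
      case (elim x)
      then have "ennreal (norm (g x)) \<le> ennreal M" using * by (rule order_trans)
      then show ?case using assms by (simp add: ennreal_le_iff)
    qed
  next
    assume "AE x in lebesgue_on S. norm (g x) \<le> M"
    then show "esssup (lebesgue_on S) ?h \<le> ennreal M"
      using g by (intro esssup_I) (auto intro: ennreal_leI elim: eventually_mono)
  qed
  then show ?thesis by (auto simp: Linf_norm_def top_unique)
qed

lemma Linf_norm_finiteE:
  assumes "Linf_norm S g < \<infinity>"
  obtains M where "M \<ge> 0" "Linf_norm S g = ennreal M" "g \<in> borel_measurable (lebesgue_on S)"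
    "AE x in lebesgue_on S. norm (g x) \<le> M"
proof -
  define M where "M = enn2real (Linf_norm S g)"
  have M: "M \<ge> 0" "Linf_norm S g = ennreal M" using assms by (auto simp: M_def less_top)
  then show ?thesis using that[of M] Linf_norm_le_iff[OF M(1), of S g] by auto
qed

lemma Linf_norm_add:
  "Linf_norm S (\<lambda>x. f x + g x) \<le> Linf_norm S f + Linf_norm S g"
proof (cases "Linf_norm S f < \<infinity> \<and> Linf_norm S g < \<infinity>")
  case True
  obtain M N where M: "M \<ge> 0" "Linf_norm S f = ennreal M" "f \<in> borel_measurable (lebesgue_on S)"
    "AE x in lebesgue_on S. norm (f x) \<le> M" and
    N: "N \<ge> 0" "Linf_norm S g = ennreal N" "g \<in> borel_measurable (lebesgue_on S)"
    "AE x in lebesgue_on S. norm (g x) \<le> N"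
    using True Linf_norm_finiteE by metis
  have "AE x in lebesgue_on S. norm (f x + g x) \<le> M + N"
    using M(4) N(4) by eventually_elim (auto intro: norm_triangle_mono)
  then have "Linf_norm S (\<lambda>x. f x + g x) \<le> ennreal (M + N)"
    using M N by (subst Linf_norm_le_iff) auto
  then show ?thesis using M N by (simp add: ennreal_plus)
next
  case False
  then show ?thesis by (auto simp: top_unique not_less)
qed

lemma Linf_norm_uminus: "Linf_norm S (\<lambda>x. - f x) = Linf_norm S f"
proof -
  have "(\<lambda>x. - f x) \<in> borel_measurable M \<longleftrightarrow> f \<in> borel_measurable M" for M
    using borel_measurable_uminus[of "\<lambda>x. - f x" M] borel_measurable_uminus[of f M] by auto
  then show ?thesis by (simp add: Linf_norm_def)
qed

lemma Linf_norm_diff: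
  "Linf_norm S (\<lambda>x. f x - g x) \<le> Linf_norm S f + Linf_norm S g"
  using Linf_norm_add[of S f "\<lambda>x. - g x"] by (simp add: Linf_norm_uminus)

lemma Linf_norm_swap_le:
  fixes F :: "'e::euclidean_space \<times> 'f::euclidean_space \<Rightarrow> complex"
  assumes S: "open S" and T: "open T"
  shows "Linf_norm (T \<times> S) (\<lambda>z. F (prod.swap z)) \<le> Linf_norm (S \<times> T) F"
proof (cases "Linf_norm (S \<times> T) F < \<infinity>")
  case True
  then obtain M where M: "M \<ge> 0" "Linf_norm (S \<times> T) F = ennreal M"
    "F \<in> borel_measurable (lebesgue_on (S \<times> T))" "AE x in lebesgue_on (S \<times> T). norm (F x) \<le> M"
    by (rule Linf_norm_finiteE)
  show ?thesis
    using AE_lebesgue_on_swap[OF S T M(4)] lebesgue_on_swap_measurable[OF S T M(3)] M(1,2)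
    by (simp add: Linf_norm_le_iff)
qed (auto simp: top_unique not_less)

lemma Linf_norm_swap:
  fixes F :: "'e::euclidean_space \<times> 'f::euclidean_space \<Rightarrow> complex"
  assumes S: "open S" and T: "open T"
  shows "Linf_norm (T \<times> S) (\<lambda>z. F (prod.swap z)) = Linf_norm (S \<times> T) F"
  using Linf_norm_swap_le[OF S T, of F] Linf_norm_swap_le[OF T S, of "\<lambda>z. F (prod.swap z)"]
  by (simp add: antisym)

section \<open>Test functions\<close>

lemma test_functionI:
  assumes "\<And>k. Ck k \<phi>" "compact K" "K \<subseteq> S" "\<And>x. \<phi> x \<noteq> 0 \<Longrightarrow> x \<in> K"
  shows "test_function S \<phi>"
proof -
  have "closure {x. \<phi> x \<noteq> 0} \<subseteq> K"
    using assms by (intro closure_minimal) (auto intro: compact_imp_closed)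
  moreover from this have "compact (closure {x. \<phi> x \<noteq> 0})"
    using closed_Int_compact[OF closed_closure assms(2), of "{x. \<phi> x \<noteq> 0}"] by (simp add: inf.absorb1)
  ultimately show ?thesis
    using assms(1,3) unfolding test_function_def by auto
qed

lemma test_functionE:
  assumes "test_function S \<phi>"
  obtains K where "compact K" "K \<subseteq> S" "\<And>x. \<phi> x \<noteq> 0 \<Longrightarrow> x \<in> K"
  using that[of "closure {x. \<phi> x \<noteq> 0}"] assms closure_subset[of "{x. \<phi> x \<noteq> 0}"]
  unfolding test_function_def by auto

lemma test_function_Ck: "test_function S \<phi> \<Longrightarrow> Ck k \<phi>"
  by (simp add: test_function_def)

lemma test_function_differentiable: "test_function S \<phi> \<Longrightarrow> \<phi> differentiable (at x)"
  using test_function_Ck[of S \<phi> "Suc 0"] by simp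

lemma test_function_continuous: "test_function S \<phi> \<Longrightarrow> continuous_on UNIV \<phi>"
  using test_function_Ck[of S \<phi> 0] by simp

lemma test_function_bounded:
  assumes "test_function S \<phi>"
  obtains M where "M \<ge> 0" "\<And>x. norm (\<phi> x) \<le> M"
proof -
  obtain K where K: "compact K" "\<And>x. \<phi> x \<noteq> 0 \<Longrightarrow> x \<in> K"
    using test_functionE[OF assms] by metis
  have "bounded (\<phi> ` K)"
    using K(1) test_function_continuous[OF assms]
    by (intro compact_imp_bounded compact_continuous_image) (auto intro: continuous_on_subset)
  then obtain M where M: "M > 0" "\<And>x. x \<in> K \<Longrightarrow> norm (\<phi> x) \<le> M"
    unfolding bounded_pos by auto
  have "norm (\<phi> x) \<le> M" for x
    using M K(2)[of x] by (cases "\<phi> x = 0") auto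
  then show ?thesis using that[of M] M(1) by auto
qed

lemma Ck_dbar_at:
  assumes "\<And>k. Ck k \<phi>"
  shows "Ck k (dbar_at L \<phi>)"
proof -
  have "dbar_at L \<phi> = (\<lambda>x. (1 / 2) * (frechet_derivative \<phi> (at x) (L 1) + \<i> * frechet_derivative \<phi> (at x) (L \<i>)))"
    by (auto simp: dbar_at_def)
  moreover have "Ck (Suc k) \<phi>" by fact
  ultimately show ?thesis
    by (auto intro!: Ck_add Ck_mult Ck_const simp del: times_divide_eq_left)
qed

text \<open>Off the compact set \<open>K\<close> the function vanishes on an open set, so its
  derivative is zero there and the support does not grow.\<close>

lemma test_function_dbar_at:
  assumes "test_function S \<phi>"
  shows "test_function S (dbar_at L \<phi>)"
proof -
  obtain K where K: "compact K" "K \<subseteq> S" "\<And>x. \<phi> x \<noteq> 0 \<Longrightarrow> x \<in> K"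
    using test_functionE[OF assms] by metis
  show ?thesis
  proof (rule test_functionI[OF Ck_dbar_at K(1,2)])
    fix x assume *: "dbar_at L \<phi> x \<noteq> 0"
    show "x \<in> K"
    proof (rule ccontr)
      assume x: "x \<notin> K"
      have "((\<lambda>_. 0) has_derivative (\<lambda>_. 0)) (at x)" by simp
      then have "(\<phi> has_derivative (\<lambda>_. 0)) (at x)"
        by (rule has_derivative_transform_within_open[where s="- K"])
           (use x K in \<open>auto simp: compact_imp_closed open_Compl\<close>)
      then have "frechet_derivative \<phi> (at x) = (\<lambda>_. 0)"
        by (rule frechet_derivative_at[symmetric])
      then show False using * by (simp add: dbar_at_def)
    qed
  qed (rule test_function_Ck[OF assms])
qed

text \<open>\<open>dbar_at\<close> has constant coefficients, so the claim reduces to the symmetry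
  of the four second derivatives in the real directions that span \<open>L\<close> and
  \<open>M\<close>.\<close>

lemma dbar_at_commute:
  assumes "test_function S \<phi>"
  shows "dbar_at L (dbar_at M \<phi>) x = dbar_at M (dbar_at L \<phi>) x"
proof -
  let ?d = "\<lambda>v x. frechet_derivative \<phi> (at x) v"
  have "Ck 2 \<phi>" using test_function_Ck[OF assms] .
  then have "?d v differentiable at x" for v x
    by (simp add: numeral_2_eq_2)
  then have d: "(?d v has_derivative frechet_derivative (?d v) (at x)) (at x)" for v x
    by (simp add: frechet_derivative_works)
  have *: "frechet_derivative (dbar_at M \<phi>) (at x) = (\<lambda>v.
     (frechet_derivative (?d (M 1)) (at x) v + \<i> * frechet_derivative (?d (M \<i>)) (at x) v) / 2)" for M x
    unfolding dbar_at_def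
    by (intro frechet_derivative_at[symmetric] bounded_linear.has_derivative[OF bounded_linear_divide]
        has_derivative_add has_derivative_mult_right d)
  have sym: "frechet_derivative (?d v) (at x) w = frechet_derivative (?d w) (at x) v" for v w
    using test_function_Ck[OF assms] by (rule Ck_frechet_derivative_commute)
  have "((a + \<i> * b) / 2 + \<i> * ((c + \<i> * d) / 2)) / 2 = ((a + \<i> * c) / 2 + \<i> * ((b + \<i> * d) / 2)) / 2"
    for a b c d :: complex
    by (simp add: field_simps)
  then show ?thesis
    unfolding dbar_at_def[of L "dbar_at M \<phi>"] dbar_at_def[of M "dbar_at L \<phi>"] *
    by (simp only: sym[of "M 1" "L 1"] sym[of "M 1" "L \<i>"] sym[of "M \<i>" "L 1"] sym[of "M \<i>" "L \<i>"])
qed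

lemma test_function_slice:
  fixes \<Phi> :: "'e::euclidean_space \<times> 'f::euclidean_space \<Rightarrow> complex"
  assumes "test_function (S \<times> T) \<Phi>"
  shows "test_function S (\<lambda>x. \<Phi> (x, y))"
proof -
  obtain K where K: "compact K" "K \<subseteq> S \<times> T" "\<And>x. \<Phi> x \<noteq> 0 \<Longrightarrow> x \<in> K"
    using test_functionE[OF assms] by metis
  show ?thesis
  proof (rule test_functionI)
    have "bounded_linear (\<lambda>x::'e. (x, 0::'f))"
      by (intro bounded_linear_Pair bounded_linear_ident bounded_linear_zero)
    from Ck_compose_affine[OF this test_function_Ck[OF assms], of _ "(0, y)"]
    show "Ck k (\<lambda>x. \<Phi> (x, y))" for k by simp
    \<comment> \<open>The support of the slice lies in the projection of the part of
      \<open>K\<close> at height \<open>y\<close>.\<close>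
    show "compact (fst ` (K \<inter> UNIV \<times> {y}))"
      by (intro compact_continuous_image compact_Int_closed K closed_Times continuous_intros
          continuous_on_fst continuous_on_id closed_UNIV closed_singleton)
    show "fst ` (K \<inter> UNIV \<times> {y}) \<subseteq> S"
      using K(2) by auto
    show "x \<in> fst ` (K \<inter> UNIV \<times> {y})" if "\<Phi> (x, y) \<noteq> 0" for x
      using K(3)[OF that] by force
  qed
qed

text \<open>These products separate the variables: tested with them, an identity on the product
  becomes an identity between slice integrals, integrated against \<open>\<psi>\<close>.\<close>

lemma test_function_tensor:
  fixes \<phi> :: "'e::euclidean_space \<Rightarrow> complex" and \<psi> :: "'f::euclidean_space \<Rightarrow> complex"
  assumes "test_function S \<phi>" "test_function T \<psi>"
  shows "test_function (S \<times> T) (\<lambda>z. \<phi> (fst z) * \<psi> (snd z))"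
proof -
  obtain K where K: "compact K" "K \<subseteq> S" "\<And>x. \<phi> x \<noteq> 0 \<Longrightarrow> x \<in> K"
    using test_functionE[OF assms(1)] by metis
  obtain K' where K': "compact K'" "K' \<subseteq> T" "\<And>x. \<psi> x \<noteq> 0 \<Longrightarrow> x \<in> K'"
    using test_functionE[OF assms(2)] by metis
  show ?thesis
  proof (rule test_functionI)
    show "Ck k (\<lambda>z. \<phi> (fst z) * \<psi> (snd z))" for k
      using Ck_compose_affine[OF bounded_linear_fst test_function_Ck[OF assms(1)], of k 0]
        Ck_compose_affine[OF bounded_linear_snd test_function_Ck[OF assms(2)], of k 0]
      by (intro Ck_mult) auto
    show "compact (K \<times> K')" using K K' by (intro compact_Times)
    show "K \<times> K' \<subseteq> S \<times> T" using K K' by auto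
    show "z \<in> K \<times> K'" if "\<phi> (fst z) * \<psi> (snd z) \<noteq> 0" for z
      using K(3)[of "fst z"] K'(3)[of "snd z"] that by (auto simp: mem_Times_iff)
  qed
qed

lemma bounded_linear_swap:
  "bounded_linear (prod.swap :: 'e::real_normed_vector \<times> 'f::real_normed_vector \<Rightarrow> _)"
  unfolding prod.swap_def
  by (intro bounded_linear_Pair bounded_linear_fst bounded_linear_snd)

lemma test_function_swap:
  fixes \<Phi> :: "'e::euclidean_space \<times> 'f::euclidean_space \<Rightarrow> complex"
  assumes "test_function (S \<times> T) \<Phi>"
  shows "test_function (T \<times> S) (\<lambda>z. \<Phi> (prod.swap z))"
proof -
  obtain K where K: "compact K" "K \<subseteq> S \<times> T" "\<And>x. \<Phi> x \<noteq> 0 \<Longrightarrow> x \<in> K"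
    using test_functionE[OF assms] by metis
  show ?thesis
  proof (rule test_functionI)
    show "Ck k (\<lambda>z. \<Phi> (prod.swap z))" for k
      using Ck_compose_affine[OF bounded_linear_swap test_function_Ck[OF assms], of k 0] by simp
    show "compact (prod.swap ` K)"
      using K(1) by (intro compact_continuous_image linear_continuous_on bounded_linear_swap)
    show "prod.swap ` K \<subseteq> T \<times> S" using K(2) by auto
    show "z \<in> prod.swap ` K" if "\<Phi> (prod.swap z) \<noteq> 0" for z
      using K(3)[OF that] by (metis image_eqI swap_swap)
  qed
qed

lemma dbar_at_slice:
  fixes \<Phi> :: "'e::euclidean_space \<times> 'f::euclidean_space \<Rightarrow> complex"
  assumes "\<Phi> differentiable (at (x, y))"
  shows "dbar_at (\<lambda>c. (L c, 0)) \<Phi> (x, y) = dbar_at L (\<lambda>x. \<Phi> (x, y)) x"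
proof -
  have "bounded_linear (\<lambda>x::'e. (x, 0::'f))"
    by (intro bounded_linear_Pair bounded_linear_ident bounded_linear_zero)
  from frechet_derivative_compose_affine[OF this, of \<Phi> x "(0, y)"] assms
  have "((\<lambda>x. \<Phi> (x, y)) has_derivative (\<lambda>v. frechet_derivative \<Phi> (at (x, y)) (v, 0))) (at x)"
    by simp
  from frechet_derivative_at[OF this] show ?thesis
    by (simp add: dbar_at_def fun_eq_iff)
qed

lemma dbar_at_swap:
  fixes \<Phi> :: "'e::euclidean_space \<times> 'f::euclidean_space \<Rightarrow> complex"
  assumes "\<Phi> differentiable (at (prod.swap z))"
  shows "dbar_at (\<lambda>c. prod.swap (L c)) (\<lambda>z. \<Phi> (prod.swap z)) z = dbar_at L \<Phi> (prod.swap z)"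
proof -
  from frechet_derivative_compose_affine[OF bounded_linear_swap, of \<Phi> z 0] assms
  have "((\<lambda>z. \<Phi> (prod.swap z)) has_derivative (\<lambda>v. frechet_derivative \<Phi> (at (prod.swap z)) (prod.swap v))) (at z)"
    by simp
  then have "frechet_derivative (\<lambda>z. \<Phi> (prod.swap z)) (at z) = (\<lambda>v. frechet_derivative \<Phi> (at (prod.swap z)) (prod.swap v))"
    by (rule frechet_derivative_at[symmetric])
  then show ?thesis
    by (simp only: dbar_at_def swap_swap)
qed

lemma dbar_at_mult_const:
  assumes "\<phi> differentiable (at x)"
  shows "dbar_at L (\<lambda>x. \<phi> x * c) x = dbar_at L \<phi> x * c"
proof -
  have "((\<lambda>x. \<phi> x * c) has_derivative (\<lambda>v. frechet_derivative \<phi> (at x) v * c)) (at x)"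
    using assms by (intro has_derivative_mult_left) (simp add: frechet_derivative_works)
  from frechet_derivative_at[OF this] show ?thesis
    by (simp add: dbar_at_def fun_eq_iff field_simps)
qed

section \<open>Bounded and locally integrable functions\<close>

text \<open>The integrand is bounded almost everywhere on a set of finite measure.\<close>

lemma Linf_norm_mult_integrable:
  fixes S :: "'e::euclidean_space set"
  assumes S: "open S" "bounded S" and g: "Linf_norm S g < \<infinity>" and \<phi>: "test_function V \<phi>"
  shows "integrable (lebesgue_on S) (\<lambda>x. g x * \<phi> x)"
proof -
  obtain M where M: "M \<ge> 0" "g \<in> borel_measurable (lebesgue_on S)"
    "AE x in lebesgue_on S. norm (g x) \<le> M"
    using Linf_norm_finiteE[OF g] by metis
  obtain N where N: "N \<ge> 0" "\<And>x. norm (\<phi> x) \<le> N"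
    using test_function_bounded[OF \<phi>] by metis
  have "S \<in> lmeasurable" using S by (intro lmeasurable_open)
  then interpret finite_measure "lebesgue_on S" by (rule finite_measure_lebesgue_on)
  show ?thesis
  proof (rule integrable_const_bound)
    show "AE x in lebesgue_on S. norm (g x * \<phi> x) \<le> M * N"
      using M(3) by eventually_elim (use M(1) N in \<open>auto simp: norm_mult intro: mult_mono\<close>)
    have "\<phi> \<in> borel_measurable (lebesgue_on S)"
      using S \<phi> by (intro continuous_imp_measurable_on_sets_lebesgue)
        (auto intro: continuous_on_subset[OF test_function_continuous])
    then show "(\<lambda>x. g x * \<phi> x) \<in> borel_measurable (lebesgue_on S)"
      using M(2) by measurable
  qed
qed

lemma Linf_norm_locally_integrable:
  fixes S :: "'e::euclidean_space set"
  assumes S: "S \<in> sets lebesgue" and g: "Linf_norm S g < \<infinity>"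
  shows "locally_integrable S g"
  unfolding locally_integrable_def
proof (intro allI impI)
  fix K assume K: "compact K \<and> K \<subseteq> S"
  obtain M where M: "M \<ge> 0" "g \<in> borel_measurable (lebesgue_on S)"
    "AE x in lebesgue_on S. norm (g x) \<le> M"
    using Linf_norm_finiteE[OF g] by metis
  have "K \<in> lmeasurable" using K by (simp add: lmeasurable_compact)
  then interpret finite_measure "lebesgue_on K" by (rule finite_measure_lebesgue_on)
  show "integrable (lebesgue_on K) g"
  proof (rule integrable_const_bound)
    have "AE x in lebesgue. x \<in> S \<longrightarrow> norm (g x) \<le> M"
      using M(3) S by (simp add: AE_lebesgue_on_iff)
    then have "AE x in lebesgue. x \<in> K \<longrightarrow> norm (g x) \<le> M"
      by eventually_elim (use K in auto)
    then show "AE x in lebesgue_on K. norm (g x) \<le> M"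
      using \<open>K \<in> lmeasurable\<close> by (simp add: AE_lebesgue_on_iff fmeasurableD)
    show "g \<in> borel_measurable (lebesgue_on K)"
      using M(2) K by (auto intro: measurable_restrict_mono)
  qed
qed

text \<open>Extended by zero, \<open>g\<close> is the pointwise limit of its restrictions to an
  exhaustion by compact sets. This extracts joint measurability from \<open>weak_dbar\<close>, which
  contains only local integrability.\<close>

lemma locally_integrable_measurable:
  fixes S :: "'e::euclidean_space set"
  assumes S: "open S" and g: "locally_integrable S g"
  shows "g \<in> borel_measurable (lebesgue_on S)"
proof -
  obtain K :: "nat \<Rightarrow> 'e set" where K: "\<And>n. compact (K n)" "\<And>n. K n \<subseteq> S"
    "\<And>C. compact C \<Longrightarrow> C \<subseteq> S \<Longrightarrow> \<exists>N. \<forall>n\<ge>N. C \<subseteq> K n"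
    using open_Union_compact_subsets[OF S] by metis
  have "(\<lambda>x. indicator (K n) x *\<^sub>R g x) \<in> borel_measurable lebesgue" for n
    using g K(1,2)[of n] borel_measurable_integrable[of "lebesgue_on (K n)" g]
    by (simp add: locally_integrable_def borel_measurable_restrict_space_iff lmeasurable_compact fmeasurableD)
  moreover have "(\<lambda>n. indicator (K n) x *\<^sub>R g x) \<longlonglongrightarrow> indicator S x *\<^sub>R g x" for x
  proof (cases "x \<in> S")
    case True
    then obtain N where "\<forall>n\<ge>N. {x} \<subseteq> K n"
      using K(3)[of "{x}"] by auto
    then have "\<forall>\<^sub>F n in sequentially. indicator S x *\<^sub>R g x = indicator (K n) x *\<^sub>R g x"
      unfolding eventually_sequentially using True by (intro exI[of _ N]) auto
    then show ?thesis by (rule Lim_transform_eventually[OF tendsto_const])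
  next
    case False
    then have "x \<notin> K n" for n using K(2) by auto
    then show ?thesis using False by simp
  qed
  ultimately have "(\<lambda>x. indicator S x *\<^sub>R g x) \<in> borel_measurable lebesgue"
    by (rule borel_measurable_LIMSEQ_metric)
  then show ?thesis using S by (simp add: borel_measurable_restrict_space_iff)
qed

section \<open>Slices of functions in the mixed spaces\<close>

lemma le_mult_of_divide_le_ennreal:
  fixes a b c :: ennreal
  assumes "a / b \<le> c" "b \<noteq> 0" "b \<noteq> top"
  shows "a \<le> c * b"
proof -
  have "a = a / b * b"
    using assms by (simp add: ennreal_divide_times ennreal_divide_self less_top)
  also have "\<dots> \<le> c * b" by (intro mult_right_mono assms) simp
  finally show ?thesis .
qed

text \<open>The bound on the product controls almost every slice, whereas the Hoelder term controls
  the difference of any two slices. Comparison with a nearby good slice reaches every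
  \<open>y\<close>.\<close>

lemma Linf_Holder_norm_slices:
  fixes S :: "'e::euclidean_space set" and T :: "'f::euclidean_space set"
  assumes S: "open S" and T: "open T" and \<alpha>: "0 < \<alpha>" and N: "N \<ge> 0"
    and g: "Linf_Holder_norm \<alpha> S T g \<le> ennreal N"
  shows "y \<in> T \<Longrightarrow> Linf_norm S (\<lambda>x. g (x, y)) \<le> ennreal N"
    and "y \<in> T \<Longrightarrow> w \<in> T \<Longrightarrow>
      Linf_norm S (\<lambda>x. g (x, y) - g (x, w)) \<le> ennreal (N * norm (y - w) powr \<alpha>)"
proof -
  let ?D = "\<lambda>y w. Linf_norm S (\<lambda>x. g (x, y) - g (x, w)) / ennreal (norm (y - w) powr \<alpha>)"
  define A where "A = Linf_norm (S \<times> T) g"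
  define H where "H = (SUP y\<in>T. SUP w\<in>T - {y}. ?D y w)"
  have AH: "A + H \<le> ennreal N"
    using g by (simp add: Linf_Holder_norm_def A_def H_def)
  \<comment> \<open>Both summands are finite and are kept as separate reals \<open>a\<close> and
    \<open>h\<close>: a good slice is bounded by \<open>a\<close>, the passage to \<open>y\<close>
    costs at most \<open>h\<close>, and together they stay within \<open>N\<close>.\<close>
  have "A \<le> ennreal N" "H \<le> ennreal N"
    using order_trans[OF _ AH] by (auto simp: add_increasing add_increasing2)
  define a where "a = enn2real A"
  define h where "h = enn2real H"
  have a: "A = ennreal a" "a \<ge> 0" and h: "H = ennreal h" "h \<ge> 0"
    using \<open>A \<le> ennreal N\<close> \<open>H \<le> ennreal N\<close>
    using le_less_trans[OF _ ennreal_less_top] by (auto simp: a_def h_def)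
  have ah: "a + h \<le> N"
    using AH N unfolding a h using a h by (simp flip: ennreal_plus)
  have diff: "Linf_norm S (\<lambda>x. g (x, y) - g (x, w)) \<le> ennreal (h * norm (y - w) powr \<alpha>)"
    if "y \<in> T" "w \<in> T" for y w
  proof (cases "w = y")
    case True
    then show ?thesis by (simp add: Linf_norm_le_iff[of 0, simplified])
  next
    case False
    then have "?D y w \<le> H"
      unfolding H_def using that by (intro SUP_upper2[of y] SUP_upper2[of w]) auto
    then have "Linf_norm S (\<lambda>x. g (x, y) - g (x, w)) \<le> H * ennreal (norm (y - w) powr \<alpha>)"
      using False by (intro le_mult_of_divide_le_ennreal) auto
    then show ?thesis using h by (simp add: ennreal_mult)
  qed
  then show "Linf_norm S (\<lambda>x. g (x, y) - g (x, w)) \<le> ennreal (N * norm (y - w) powr \<alpha>)"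
    if "y \<in> T" "w \<in> T"
    using that ah a(2) by (intro order_trans[OF diff ennreal_leI] mult_right_mono) auto
  show "Linf_norm S (\<lambda>x. g (x, y)) \<le> ennreal N" if y: "y \<in> T"
  proof -
    have gA: "g \<in> borel_measurable (lebesgue_on (S \<times> T))" "AE z in lebesgue_on (S \<times> T). norm (g z) \<le> a"
      using Linf_norm_le_iff[OF a(2), of "S \<times> T" g] a(1) unfolding A_def by auto
    have "AE w in lebesgue_on T. Linf_norm S (\<lambda>x. g (x, w)) \<le> ennreal a"
      using measurable_lebesgue_on_slice[OF S T gA(1)] AE_lebesgue_on_slice[OF S T gA(2)]
      by eventually_elim (simp add: Linf_norm_le_iff a(2))
    then obtain X where X: "\<And>n. X n \<in> T" "\<And>n. Linf_norm S (\<lambda>x. g (x, X n)) \<le> ennreal a" "X \<longlonglongrightarrow> y"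
      by (rule AE_lebesgue_on_open_approx[OF T _ y]) (rule that)
    from X(3) have "\<forall>\<^sub>F n in sequentially. dist (X n) y < 1"
      by (rule tendstoD) simp
    then obtain n where n: "dist (X n) y < 1"
      by (auto simp: eventually_sequentially)
    \<comment> \<open>One good slice at distance less than 1 is enough; no limit is taken.\<close>
    have "norm (y - X n) powr \<alpha> \<le> 1 powr \<alpha>"
      using n \<alpha> by (intro powr_mono2) (auto simp: dist_norm norm_minus_commute)
    then have *: "h * norm (y - X n) powr \<alpha> \<le> h * 1"
      using h(2) by (intro mult_left_mono) auto
    have "Linf_norm S (\<lambda>x. g (x, y)) = Linf_norm S (\<lambda>x. g (x, X n) + (g (x, y) - g (x, X n)))"
      by simp
    also have "\<dots> \<le> ennreal a + ennreal (h * norm (y - X n) powr \<alpha>)"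
      by (rule order_trans[OF Linf_norm_add add_mono[OF X(2) diff[OF y X(1)]]])
    also have "\<dots> = ennreal (a + h * norm (y - X n) powr \<alpha>)"
      using a h by (simp add: ennreal_plus)
    also have "\<dots> \<le> ennreal N"
      using ah * by (intro ennreal_leI) auto
    finally show ?thesis .
  qed
qed

section \<open>Pointwise form of the operator bound\<close>

lemma Linf_form_norm_le:
  assumes "\<And>i. Linf_norm S (\<beta> i) \<le> ennreal (N i)" "\<And>i. N i \<ge> 0"
  shows "Linf_form_norm S \<beta> \<le> ennreal (\<Sum>i\<in>UNIV. N i)"
  using assms sum_mono[of UNIV "\<lambda>i. Linf_norm S (\<beta> i)" "\<lambda>i. ennreal (N i)"]
  by (simp add: Linf_form_norm_def sum_ennreal)

text \<open>The Hoelder term of the norm is a supremum over all pairs of points, so it binds the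
  function at every point; it also spreads the almost everywhere bound to all of
  \<open>S\<close>.\<close>

lemma bounded_operator_bounds:
  fixes T :: "('i::finite, 'e::euclidean_space) form01 \<Rightarrow> 'e \<Rightarrow> complex"
  assumes op: "bounded_operator_Linf_Holder \<alpha> S T" and S: "open S" and \<alpha>: "0 < \<alpha>"
  obtains C where "C \<ge> 0"
    "\<And>\<beta> M z. \<lbrakk>M \<ge> 0; Linf_form_norm S \<beta> \<le> ennreal M; z \<in> S\<rbrakk> \<Longrightarrow> norm (T \<beta> z) \<le> C * M"
    "\<And>\<beta> M z w. \<lbrakk>M \<ge> 0; Linf_form_norm S \<beta> \<le> ennreal M; z \<in> S; w \<in> S\<rbrakk> \<Longrightarrow>
       norm (T \<beta> z - T \<beta> w) \<le> C * M * norm (z - w) powr \<alpha>"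
proof -
  from op obtain C where C: "\<And>\<beta>. Linf_form_norm S \<beta> < \<infinity> \<Longrightarrow>
        Holder_norm \<alpha> S (T \<beta>) \<le> ennreal C * Linf_form_norm S \<beta>"
    unfolding bounded_operator_Linf_Holder_def by blast
  \<comment> \<open>The given \<open>C\<close> may be negative, where \<open>ennreal C\<close> is 0;
    truncation does not change the bound and allows real arithmetic.\<close>
  define K where "K = max C 0"
  have K: "K \<ge> 0" by (simp add: K_def)
  have norm: "Holder_norm \<alpha> S (T \<beta>) \<le> ennreal (K * M)"
    if M: "M \<ge> 0" "Linf_form_norm S \<beta> \<le> ennreal M" for \<beta> M
  proof -
    have "Linf_form_norm S \<beta> < \<infinity>" using M(2) by (auto intro: le_less_trans)
    from C[OF this] have "Holder_norm \<alpha> S (T \<beta>) \<le> ennreal C * Linf_form_norm S \<beta>" .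
    also have "\<dots> \<le> ennreal K * ennreal M"
      using M by (intro mult_mono) (auto simp: K_def ennreal_leI)
    finally show ?thesis using K M by (simp add: ennreal_mult)
  qed
  have holder: "norm (T \<beta> z - T \<beta> w) \<le> K * M * norm (z - w) powr \<alpha>"
    if M: "M \<ge> 0" "Linf_form_norm S \<beta> \<le> ennreal M" and zw: "z \<in> S" "w \<in> S" for \<beta> M z w
  proof (cases "z = w")
    case False
    let ?Q = "\<lambda>z w. ennreal (norm (T \<beta> z - T \<beta> w) / norm (z - w) powr \<alpha>)"
    have "?Q z w \<le> (SUP z\<in>S. SUP w\<in>S - {z}. ?Q z w)"
      using zw False by (intro SUP_upper2[of z] SUP_upper2[of w]) auto
    also have "\<dots> \<le> Holder_norm \<alpha> S (T \<beta>)"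
      unfolding Holder_norm_def by (simp add: add_increasing)
    also have "\<dots> \<le> ennreal (K * M)" by (rule norm[OF M])
    finally have "norm (T \<beta> z - T \<beta> w) / norm (z - w) powr \<alpha> \<le> K * M"
      using K M by (simp add: ennreal_le_iff)
    then show ?thesis using False by (simp add: pos_divide_le_eq)
  qed simp
  have bound: "norm (T \<beta> z) \<le> 2 * K * M"
    if M: "M \<ge> 0" "Linf_form_norm S \<beta> \<le> ennreal M" and z: "z \<in> S" for \<beta> M z
  proof -
    have "Linf_norm S (T \<beta>) \<le> Holder_norm \<alpha> S (T \<beta>)"
      unfolding Holder_norm_def by (simp add: add_increasing2)
    also note norm[OF M]
    finally have "AE x in lebesgue_on S. norm (T \<beta> x) \<le> K * M"
      using K M by (subst (asm) Linf_norm_le_iff) auto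
    then obtain X where X: "\<And>n. X n \<in> S" "\<And>n. norm (T \<beta> (X n)) \<le> K * M" "X \<longlonglongrightarrow> z"
      by (rule AE_lebesgue_on_open_approx[OF S _ z]) (rule that)
    from X(3) have "\<forall>\<^sub>F n in sequentially. dist (X n) z < 1"
      by (rule tendstoD) simp
    then obtain n where n: "dist (X n) z < 1"
      by (auto simp: eventually_sequentially)
    have "norm (z - X n) powr \<alpha> \<le> 1 powr \<alpha>"
      using n \<alpha> by (intro powr_mono2) (auto simp: dist_norm norm_minus_commute)
    \<comment> \<open>A good point within distance 1 contributes \<open>K * M\<close> and the
      oscillation contributes \<open>K * M\<close> again, which is the origin of the factor
      2.\<close>
    then have "norm (T \<beta> z - T \<beta> (X n)) \<le> K * M * 1"
      using K M by (intro order_trans[OF holder[OF M z X(1)]] mult_left_mono) auto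
    with X(2)[of n] norm_triangle_sub[of "T \<beta> z" "T \<beta> (X n)"] show ?thesis by linarith
  qed
  show ?thesis
  proof (rule that[of "2 * K"])
    fix \<beta> :: "('i, 'e) form01" and M z w
    assume M: "M \<ge> 0" "Linf_form_norm S \<beta> \<le> ennreal M" "z \<in> S" "w \<in> S"
    have "K * M * norm (z - w) powr \<alpha> \<le> 2 * K * M * norm (z - w) powr \<alpha>"
      using K M by (intro mult_right_mono) auto
    then show "norm (T \<beta> z - T \<beta> w) \<le> 2 * K * M * norm (z - w) powr \<alpha>"
      using holder[OF M] by linarith
  qed (use K bound in auto)
qed

lemma bounded_operator_diff:
  assumes op: "bounded_operator_Linf_Holder \<alpha> S T"
    and "Linf_form_norm S \<beta> < \<infinity>" "Linf_form_norm S \<gamma> < \<infinity>" "z \<in> S"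
  shows "T (\<lambda>i x. \<beta> i x - \<gamma> i x) z = T \<beta> z - T \<gamma> z"
proof -
  have m: "Linf_form_norm S (\<lambda>i x. (- 1) * \<gamma> i x) < \<infinity>"
    using assms(3) by (simp add: Linf_form_norm_def Linf_norm_uminus)
  have "T (\<lambda>i x. \<beta> i x + (- 1) * \<gamma> i x) z = T \<beta> z + T (\<lambda>i x. (- 1) * \<gamma> i x) z"
    using op assms(2,4) m unfolding bounded_operator_Linf_Holder_def by blast
  also have "T (\<lambda>i x. (- 1) * \<gamma> i x) z = (- 1) * T \<gamma> z"
    using op assms(3,4) unfolding bounded_operator_Linf_Holder_def by blast
  finally show ?thesis by simp
qed

lemma bounded_operator_zero:
  assumes op: "bounded_operator_Linf_Holder \<alpha> S T" and "z \<in> S"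
  shows "T (\<lambda>i x. 0) z = 0"
proof -
  have "Linf_norm S (\<lambda>x. 0) \<le> ennreal 0"
    by (subst Linf_norm_le_iff) auto
  then have "Linf_form_norm S (\<lambda>i x. 0) < \<infinity>"
    by (simp add: Linf_form_norm_def)
  then have "T (\<lambda>i x. 0 * 0) z = 0 * T (\<lambda>i x. 0) z"
    using op assms(2) unfolding bounded_operator_Linf_Holder_def by blast
  then show ?thesis by simp
qed

section \<open>Continuity of slice integrals and closedness of slices\<close>

text \<open>\<open>B\<close> may be unbounded near the boundary of \<open>T\<close>; the compact
  support of \<open>\<psi>\<close> gives integrability.\<close>

lemma continuous_mult_test_integrable:
  fixes B :: "'f::euclidean_space \<Rightarrow> complex"
  assumes T: "open T" and B: "continuous_on T B" and \<psi>: "test_function T \<psi>"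
  shows "integrable (lebesgue_on T) (\<lambda>y. B y * \<psi> y)"
proof -
  obtain K where K: "compact K" "K \<subseteq> T" "\<And>x. \<psi> x \<noteq> 0 \<Longrightarrow> x \<in> K"
    using test_functionE[OF \<psi>] by metis
  have "integrable lborel (\<lambda>y. indicator K y *\<^sub>R (B y * \<psi> y))"
    using B K test_function_continuous[OF \<psi>]
    by (intro borel_integrable_compact continuous_intros) (auto intro: continuous_on_subset)
  then have "integrable lebesgue (\<lambda>y. indicator K y *\<^sub>R (B y * \<psi> y))"
    by (simp add: integrable_completion borel_measurable_integrable)
  moreover have "indicator K y *\<^sub>R (B y * \<psi> y) = indicator T y *\<^sub>R (B y * \<psi> y)" for y
    using K(2) K(3)[of y] by (auto simp: indicator_def)
  ultimately show ?thesis using T by (simp add: integrable_restrict_space)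
qed

text \<open>Only continuous functions need the fundamental lemma of the calculus of variations, because
  the slice integrals below depend continuously on the parameter.\<close>

lemma continuous_test_integral_zero:
  fixes B :: "'f::euclidean_space \<Rightarrow> complex"
  assumes T: "open T" and B: "continuous_on T B"
    and zero: "\<And>\<psi>. test_function T \<psi> \<Longrightarrow> (LINT y|lebesgue_on T. B y * \<psi> y) = 0"
    and y0: "y0 \<in> T"
  shows "B y0 = 0"
proof (rule ccontr)
  assume nz: "B y0 \<noteq> 0"
  \<comment> \<open>Normalised so that \<open>Q y0 = 1\<close>. The real part is then positive near
    \<open>y0\<close>, and testing it with a nonnegative bump yields the contradiction.\<close>
  define Q where "Q y = B y / B y0" for y
  have Q: "continuous_on T Q" unfolding Q_def using B nz by (intro continuous_intros) auto
  have "isCont Q y0" using Q T y0 continuous_on_eq_continuous_at by blast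
  then obtain d where d: "d > 0" "\<And>y. dist y y0 < d \<Longrightarrow> dist (Q y) (Q y0) < 1 / 2"
    unfolding continuous_at_eps_delta by (metis half_gt_zero_iff zero_less_one)
  obtain e where e: "e > 0" "cball y0 e \<subseteq> T"
    using T y0 open_contains_cball by blast
  define r where "r = min (d / 2) e"
  have r: "r > 0" "r < d" "cball y0 r \<subseteq> T" using d e by (auto simp: r_def)
  have ReQ: "Re (Q y) > 0" if "y \<in> cball y0 r" for y
  proof -
    have "dist (Q y) (Q y0) < 1 / 2"
      using that r by (intro d) (auto simp: dist_commute)
    moreover have "Q y0 = 1" using nz by (simp add: Q_def)
    ultimately have "norm (1 - Q y) < 1 / 2" by (simp add: dist_norm norm_minus_commute)
    then show ?thesis using complex_Re_le_cmod[of "1 - Q y"] by simp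
  qed
  define b where "b y = flat_exp 0 (r\<^sup>2 - (y - y0) \<bullet> (y - y0))" for y
  define \<psi> where "\<psi> y = complex_of_real (b y)" for y
  have b_nonneg: "b y \<ge> 0" for y by (simp add: b_def flat_exp_def)
  have b_pos: "b y > 0 \<longleftrightarrow> y \<in> ball y0 r" for y
  proof -
    have "y \<in> ball y0 r \<longleftrightarrow> (norm (y - y0))\<^sup>2 < r\<^sup>2"
      using r(1) by (auto simp: dist_norm norm_minus_commute abs_le_square_iff power2_less_imp_less
          intro: power_strict_mono)
    then show ?thesis by (simp add: b_def flat_exp_def power2_norm_eq_inner)
  qed
  have \<psi>: "test_function T \<psi>"
  proof (rule test_functionI)
    show "Ck k \<psi>" for k unfolding \<psi>_def b_def by (rule Ck_flat_exp_ball)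
    show "y \<in> cball y0 r" if "\<psi> y \<noteq> 0" for y
      using b_pos[of y] b_nonneg[of y] that by (auto simp: \<psi>_def less_le)
  qed (use r in auto)
  define F where "F y = Q y * \<psi> y" for y
  have F: "integrable (lebesgue_on T) F"
    unfolding F_def by (rule continuous_mult_test_integrable[OF T Q \<psi>])
  have "integral\<^sup>L (lebesgue_on T) F = (LINT y|lebesgue_on T. (B y * \<psi> y) * inverse (B y0))"
    by (simp add: F_def[abs_def] Q_def field_simps)
  also have "\<dots> = 0" using zero[OF \<psi>] by (simp only: integral_mult_left_zero) simp
  finally have "integral\<^sup>L (lebesgue_on T) F = 0" .
  then have int0: "(LINT y|lebesgue_on T. Re (F y)) = 0"
    using integral_Re[OF F] by simp
  have ReF: "Re (F y) = Re (Q y) * b y" for y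
    by (simp add: F_def \<psi>_def)
  \<comment> \<open>Off the ball the sign of \<open>Re (Q y)\<close> is unknown, but the bump is
    zero there.\<close>
  have "Re (F y) \<ge> 0" for y
    using ReQ[of y] b_nonneg[of y] b_pos[of y] unfolding ReF
    by (cases "b y = 0") (auto simp: less_le intro!: mult_nonneg_nonneg)
  then have "AE y in lebesgue_on T. 0 \<le> Re (F y)" by simp
  from integral_nonneg_eq_0_iff_AE[OF integrable_Re[OF F] this] int0
  have "AE y in lebesgue_on T. Re (F y) = 0" by simp
  then have "AE y in lebesgue_on (ball y0 r). Re (F y) = 0"
    using T r(3) by (auto simp: AE_lebesgue_on_iff elim!: eventually_mono dest!: subsetD)
  then obtain X where "\<And>n. X n \<in> ball y0 r" "\<And>n. Re (F (X n)) = 0" "X \<longlonglongrightarrow> y0"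
    using r(1) by (elim AE_lebesgue_on_open_approx[OF open_ball, where x=y0]) auto
  then have "X 0 \<in> ball y0 r" "Re (F (X 0)) = 0" by auto
  moreover have "Re (Q (X 0)) > 0" "b (X 0) > 0"
    using ReQ b_pos \<open>X 0 \<in> ball y0 r\<close> by auto
  ultimately show False by (simp add: ReF)
qed

text \<open>With M a bound for \<open>\<phi>\<close> and |S| the measure of \<open>S\<close>, the
  integrals at \<open>y\<close> and \<open>w\<close> differ by at most N M |S| |y -
  w|^\<alpha>.\<close>

lemma slice_integral_continuous:
  fixes S :: "'e::euclidean_space set" and T :: "'f::euclidean_space set"
  assumes S: "open S" "bounded S" and T: "open T" and \<alpha>: "0 < \<alpha>" and N: "N \<ge> 0"
    and g: "Linf_Holder_norm \<alpha> S T g \<le> ennreal N" and \<phi>: "test_function V \<phi>"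
  shows "continuous_on T (\<lambda>y. LINT x|lebesgue_on S. g (x, y) * \<phi> x)"
proof -
  note slices = Linf_Holder_norm_slices[OF S(1) T \<alpha> N g]
  obtain M where M: "M \<ge> 0" "\<And>x. norm (\<phi> x) \<le> M"
    using test_function_bounded[OF \<phi>] by metis
  let ?v = "measure (lebesgue_on S) S"
  let ?B = "\<lambda>y. LINT x|lebesgue_on S. g (x, y) * \<phi> x"
  have "S \<in> lmeasurable" using S by (intro lmeasurable_open)
  then interpret finite_measure "lebesgue_on S" by (rule finite_measure_lebesgue_on)
  have est: "norm (?B y - ?B w) \<le> N * norm (y - w) powr \<alpha> * M * ?v" if yw: "y \<in> T" "w \<in> T" for y w
  proof -
    have int: "integrable (lebesgue_on S) (\<lambda>x. g (x, y) * \<phi> x)" if "y \<in> T" for y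
      using slices(1)[OF that] by (intro Linf_norm_mult_integrable[OF S _ \<phi>]) (auto intro: le_less_trans)
    have K: "N * norm (y - w) powr \<alpha> \<ge> 0" using N by simp
    have "AE x in lebesgue_on S. norm (g (x, y) - g (x, w)) \<le> N * norm (y - w) powr \<alpha>"
      using iffD1[OF Linf_norm_le_iff[OF K] slices(2)[OF yw]] by (rule conjunct2)
    then have ae: "AE x in lebesgue_on S. norm (g (x, y) * \<phi> x - g (x, w) * \<phi> x) \<le> N * norm (y - w) powr \<alpha> * M"
      by eventually_elim
        (use K M in \<open>auto simp: norm_mult left_diff_distrib[symmetric] intro: mult_mono\<close>)
    have "norm (?B y - ?B w) = norm (LINT x|lebesgue_on S. g (x, y) * \<phi> x - g (x, w) * \<phi> x)"
      using int yw by simp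
    also have "\<dots> \<le> (LINT x|lebesgue_on S. norm (g (x, y) * \<phi> x - g (x, w) * \<phi> x))"
      by (rule integral_norm_bound)
    also have "\<dots> \<le> (LINT x|lebesgue_on S. N * norm (y - w) powr \<alpha> * M)"
      using int yw ae by (intro integral_mono_AE) auto
    also have "\<dots> = N * norm (y - w) powr \<alpha> * M * ?v"
      by simp
    finally show ?thesis .
  qed
  show ?thesis
    unfolding continuous_on_def
  proof
    fix w assume w: "w \<in> T"
    have "((\<lambda>y. norm (y - w)) \<longlongrightarrow> norm (w - w)) (at w within T)"
      by (intro tendsto_intros)
    then have "((\<lambda>y. norm (y - w) powr \<alpha>) \<longlongrightarrow> 0) (at w within T)"
      using \<alpha> by (intro tendsto_zero_powrI[where b=\<alpha>]) auto
    then have "((\<lambda>y. N * norm (y - w) powr \<alpha> * M * ?v) \<longlongrightarrow> N * 0 * M * ?v) (at w within T)"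
      by (intro tendsto_intros)
    then have "((\<lambda>y. N * norm (y - w) powr \<alpha> * M * ?v) \<longlongrightarrow> 0) (at w within T)"
      by simp
    moreover have "\<forall>\<^sub>F y in at w within T. norm (?B y - ?B w) \<le> N * norm (y - w) powr \<alpha> * M * ?v"
      using est w by (auto simp: eventually_at_filter)
    ultimately have "((\<lambda>y. ?B y - ?B w) \<longlongrightarrow> 0) (at w within T)"
      by (rule Lim_null_comparison[rotated])
    then show "(?B \<longlongrightarrow> ?B w) (at w within T)"
      by (rule LIM_zero_cancel)
  qed
qed

lemma tensor_integral:
  fixes S :: "'e::euclidean_space set" and T :: "'f::euclidean_space set"
  assumes S: "open S" "bounded S" and T: "open T" "bounded T"
    and g: "Linf_norm (S \<times> T) g < \<infinity>" and \<phi>: "test_function S \<phi>" and \<psi>: "test_function T \<psi>"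
  shows "(LINT z|lebesgue_on (S \<times> T). g z * (\<phi> (fst z) * \<psi> (snd z))) =
    (LINT y|lebesgue_on T. (LINT x|lebesgue_on S. g (x, y) * \<phi> x) * \<psi> y)"
proof -
  have "integrable (lebesgue_on (S \<times> T)) (\<lambda>z. g z * (\<phi> (fst z) * \<psi> (snd z)))"
    using S T by (intro Linf_norm_mult_integrable[OF _ _ g test_function_tensor[OF \<phi> \<psi>]])
      (auto intro: open_Times bounded_Times)
  from Fubini_lebesgue_on[OF S(1) T(1) this] show ?thesis
    by (simp flip: mult.assoc)
qed

lemma Linf_norm_le_Linf_Holder_norm: "Linf_norm (S \<times> T) g \<le> Linf_Holder_norm \<alpha> S T g"
  by (simp add: Linf_Holder_norm_def add_increasing2)

text \<open>Closedness tested with \<open>\<phi> (fst z) * \<psi> (snd z)\<close> says that the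
  defect of closedness of the slice, tested with \<open>\<phi>\<close>, integrates to zero against
  every \<open>\<psi>\<close>. This defect is continuous in \<open>y\<close>, so it vanishes at each
  \<open>y\<close>.\<close>

lemma dbar_closed_slice:
  fixes S :: "'e::euclidean_space set" and T :: "'f::euclidean_space set"
  assumes S: "open S" "bounded S" and T: "open T" "bounded T" and \<alpha>: "0 < \<alpha>"
    and N: "\<And>i. N i \<ge> 0" "\<And>i. Linf_Holder_norm \<alpha> S T (g i) \<le> ennreal (N i)"
    and closed: "dbar_closed (\<lambda>i c. (L i c, 0)) (S \<times> T) g" and y: "y \<in> T"
  shows "dbar_closed L S (\<lambda>i x. g i (x, y))"
  unfolding dbar_closed_def
proof (intro conjI allI impI)
  fix i show "locally_integrable S (\<lambda>x. g i (x, y))"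
    using S Linf_Holder_norm_slices(1)[OF S(1) T(1) \<alpha> N y]
    by (intro Linf_norm_locally_integrable) (auto intro: le_less_trans[OF _ ennreal_less_top])
next
  fix i j \<phi> assume \<phi>: "test_function S \<phi>"
  let ?B = "\<lambda>i j y. LINT x|lebesgue_on S. g i (x, y) * dbar_at (L j) \<phi> x"
  have cont: "continuous_on T (?B i j)" for i j
    by (rule slice_integral_continuous[OF S T(1) \<alpha> N test_function_dbar_at[OF \<phi>]])
  have "?B i j y - ?B j i y = 0"
  proof (rule continuous_test_integral_zero[OF T(1) _ _ y])
    show "continuous_on T (\<lambda>y. ?B i j y - ?B j i y)"
      by (intro continuous_intros cont)
    fix \<psi> assume \<psi>: "test_function T \<psi>"
    let ?\<Phi> = "\<lambda>z. \<phi> (fst z) * \<psi> (snd z)"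
    have d: "dbar_at (\<lambda>c. (L j c, 0)) ?\<Phi> z = dbar_at (L j) \<phi> (fst z) * \<psi> (snd z)" for j z
    proof -
      have "dbar_at (\<lambda>c. (L j c, 0)) ?\<Phi> (fst z, snd z) = dbar_at (L j) (\<lambda>x. \<phi> x * \<psi> (snd z)) (fst z)"
        by (subst dbar_at_slice) (simp_all add: test_function_differentiable[OF test_function_tensor[OF \<phi> \<psi>]])
      then show ?thesis
        by (simp add: dbar_at_mult_const test_function_differentiable[OF \<phi>])
    qed
    have fin: "Linf_norm (S \<times> T) (g i) < \<infinity>" for i
      using order_trans[OF Linf_norm_le_Linf_Holder_norm N(2)] le_less_trans[OF _ ennreal_less_top] by auto
    have eq: "(LINT y|lebesgue_on T. ?B i j y * \<psi> y) =
        (LINT z|lebesgue_on (S \<times> T). g i z * dbar_at (\<lambda>c. (L j c, 0)) ?\<Phi> z)" for i j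
      unfolding d by (rule tensor_integral[OF S T fin test_function_dbar_at[OF \<phi>] \<psi>, symmetric])
    have "(LINT y|lebesgue_on T. ?B i j y * \<psi> y) = (LINT y|lebesgue_on T. ?B j i y * \<psi> y)"
      unfolding eq using closed test_function_tensor[OF \<phi> \<psi>] unfolding dbar_closed_def by blast
    moreover have "integrable (lebesgue_on T) (\<lambda>y. ?B i j y * \<psi> y)" for i j
      by (rule continuous_mult_test_integrable[OF T(1) cont \<psi>])
    ultimately show "(LINT y|lebesgue_on T. (?B i j y - ?B j i y) * \<psi> y) = 0"
      by (simp add: left_diff_distrib)
  qed
  then show "?B i j y = ?B j i y" by simp
qed

section \<open>Slicewise action of a solution operator\<close>

lemma iterated_Holder_norm_le:
  fixes S :: "'e::euclidean_space set" and T :: "'f::euclidean_space set"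
  assumes m: "u \<in> borel_measurable (lebesgue_on (S \<times> T))" and K: "K \<ge> 0"
    and b: "\<And>x y. x \<in> S \<Longrightarrow> y \<in> T \<Longrightarrow> norm (u (x, y)) \<le> K"
    and d: "\<And>x x' y y'. \<lbrakk>x \<in> S; x' \<in> S; y \<in> T; y' \<in> T\<rbrakk> \<Longrightarrow>
      norm (u (x, y) - u (x', y) - u (x, y') + u (x', y'))
        \<le> K * (norm (x - x') powr \<alpha>1 * norm (y - y') powr \<alpha>2)"
  shows "iterated_Holder_norm \<alpha>1 \<alpha>2 S T u \<le> ennreal (2 * K)"
proof -
  have 1: "Linf_norm (S \<times> T) u \<le> ennreal K"
    using m b by (subst Linf_norm_le_iff[OF K]) (auto intro!: AE_I2)
  have 2: "norm (u (x, y) - u (x', y) - u (x, y') + u (x', y')) /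
      (norm (x - x') powr \<alpha>1 * norm (y - y') powr \<alpha>2) \<le> K"
    if "x \<in> S" "x' \<in> S - {x}" "y \<in> T" "y' \<in> T - {y}" for x x' y y'
  proof -
    have "norm (x - x') powr \<alpha>1 * norm (y - y') powr \<alpha>2 > 0"
      using that by (intro mult_pos_pos) auto
    then show ?thesis using d[of x x' y y'] that by (simp add: pos_divide_le_eq)
  qed
  have "iterated_Holder_norm \<alpha>1 \<alpha>2 S T u \<le> ennreal K + ennreal K"
    unfolding iterated_Holder_norm_def
    by (intro add_mono 1 SUP_least ennreal_leI 2)
  then show ?thesis using K by (simp flip: ennreal_plus)
qed

text \<open>By linearity a difference in \<open>y\<close> is \<open>A\<close> applied to the
  difference of two slices, whose size is a power of |y - y'|. The sup bound of \<open>A\<close>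
  then gives Hoelder continuity in \<open>y\<close>, and the Hoelder bound of \<open>A\<close> gives
  the mixed difference.\<close>

lemma act1_estimates:
  fixes S :: "'e::euclidean_space set" and T :: "'f::euclidean_space set"
    and A :: "('i::finite, 'e) form01 \<Rightarrow> 'e \<Rightarrow> complex"
  assumes S: "open S" and T: "open T" and \<alpha>1: "0 < \<alpha>1" and \<alpha>2: "0 < \<alpha>2"
    and op: "bounded_operator_Linf_Holder \<alpha>1 S A"
  obtains C where "C \<ge> 0"
    "\<And>(g :: ('i, 'e \<times> 'f) form01) N. \<lbrakk>\<And>i. N i \<ge> 0; \<And>i. Linf_Holder_norm \<alpha>2 S T (g i) \<le> ennreal (N i)\<rbrakk> \<Longrightarrow>
      act1 A g \<in> borel_measurable (lebesgue_on (S \<times> T)) \<and>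
      iterated_Holder_norm \<alpha>1 \<alpha>2 S T (act1 A g) \<le> ennreal (C * (\<Sum>i\<in>UNIV. N i))"
proof -
  obtain C where C: "C \<ge> 0"
    and Cb: "\<And>\<beta> M z. \<lbrakk>M \<ge> 0; Linf_form_norm S \<beta> \<le> ennreal M; z \<in> S\<rbrakk> \<Longrightarrow> norm (A \<beta> z) \<le> C * M"
    and Ch: "\<And>\<beta> M z w. \<lbrakk>M \<ge> 0; Linf_form_norm S \<beta> \<le> ennreal M; z \<in> S; w \<in> S\<rbrakk> \<Longrightarrow>
       norm (A \<beta> z - A \<beta> w) \<le> C * M * norm (z - w) powr \<alpha>1"
    using bounded_operator_bounds[OF op S \<alpha>1] by blast
  show ?thesis
  proof (rule that[of "2 * C"])
    fix g :: "('i, 'e \<times> 'f) form01" and N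
    assume N: "\<And>i. N i \<ge> 0" "\<And>i. Linf_Holder_norm \<alpha>2 S T (g i) \<le> ennreal (N i)"
    define n where "n = (\<Sum>i\<in>UNIV. N i)"
    define \<beta> where "\<beta> y = (\<lambda>i x. g i (x, y))" for y
    define u where "u = act1 A g"
    have u: "u (x, y) = A (\<beta> y) x" for x y by (simp add: u_def act1_def \<beta>_def)
    have n: "n \<ge> 0" unfolding n_def by (intro sum_nonneg N)
    have \<beta>1: "Linf_form_norm S (\<beta> y) \<le> ennreal n" if "y \<in> T" for y
      unfolding \<beta>_def n_def
      by (intro Linf_form_norm_le Linf_Holder_norm_slices(1)[OF S T \<alpha>2 N] that N)
    have \<beta>2: "Linf_form_norm S (\<lambda>i x. \<beta> y i x - \<beta> y' i x) \<le> ennreal (n * norm (y - y') powr \<alpha>2)"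
      if "y \<in> T" "y' \<in> T" for y y'
      unfolding \<beta>_def n_def sum_distrib_right
      by (intro Linf_form_norm_le Linf_Holder_norm_slices(2)[OF S T \<alpha>2 N] that N mult_nonneg_nonneg) simp
    have diff: "A (\<lambda>i x. \<beta> y i x - \<beta> y' i x) x = u (x, y) - u (x, y')" if "x \<in> S" "y \<in> T" "y' \<in> T" for x y y'
      unfolding u using that \<beta>1 le_less_trans[OF _ ennreal_less_top]
      by (intro bounded_operator_diff[OF op]) auto
    have ub: "norm (u (x, y)) \<le> C * n" if "x \<in> S" "y \<in> T" for x y
      unfolding u using that by (intro Cb n \<beta>1)
    have uh1: "norm (u (x, y) - u (x', y)) \<le> C * n * norm (x - x') powr \<alpha>1"
      if "x \<in> S" "x' \<in> S" "y \<in> T" for x x' y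
      unfolding u using that by (intro Ch n \<beta>1)
    have uh2: "norm (u (x, y) - u (x, y')) \<le> C * (n * norm (y - y') powr \<alpha>2)"
      if "x \<in> S" "y \<in> T" "y' \<in> T" for x y y'
      unfolding diff[OF that, symmetric] using that n by (intro Cb \<beta>2 mult_nonneg_nonneg) auto
    have uh12: "norm (u (x, y) - u (x', y) - u (x, y') + u (x', y'))
        \<le> C * n * (norm (x - x') powr \<alpha>1 * norm (y - y') powr \<alpha>2)"
      if "x \<in> S" "x' \<in> S" "y \<in> T" "y' \<in> T" for x x' y y'
    proof -
      have "norm (A (\<lambda>i x. \<beta> y i x - \<beta> y' i x) x - A (\<lambda>i x. \<beta> y i x - \<beta> y' i x) x')
          \<le> C * (n * norm (y - y') powr \<alpha>2) * norm (x - x') powr \<alpha>1"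
        using that n by (intro Ch \<beta>2) auto
      then show ?thesis using that by (simp add: diff algebra_simps)
    qed
    \<comment> \<open>Joint measurability is obtained from continuity: the sum of the separate
      Hoelder bounds in \<open>x\<close> and in \<open>y\<close>, each uniform in the other
      variable, dominates the increment.\<close>
    have "continuous_on (S \<times> T) u"
      unfolding continuous_on_def
    proof
      fix p assume p: "p \<in> S \<times> T"
      let ?F = "at p within S \<times> T"
      let ?E = "\<lambda>q. C * n * norm (fst q - fst p) powr \<alpha>1 + C * (n * norm (snd q - snd p) powr \<alpha>2)"
      have "((\<lambda>q. norm (fst q - fst p)) \<longlongrightarrow> norm (fst p - fst p)) ?F"
        "((\<lambda>q. norm (snd q - snd p)) \<longlongrightarrow> norm (snd p - snd p)) ?F"
        by (intro tendsto_intros)+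
      then have "((\<lambda>q. norm (fst q - fst p) powr \<alpha>1) \<longlongrightarrow> 0) ?F" "((\<lambda>q. norm (snd q - snd p) powr \<alpha>2) \<longlongrightarrow> 0) ?F"
        using \<alpha>1 \<alpha>2 tendsto_zero_powrI[of _ ?F "\<lambda>_. \<alpha>1" \<alpha>1] tendsto_zero_powrI[of _ ?F "\<lambda>_. \<alpha>2" \<alpha>2] by auto
      then have "(?E \<longlongrightarrow> C * n * 0 + C * (n * 0)) ?F"
        by (intro tendsto_intros)
      then have E: "(?E \<longlongrightarrow> 0) ?F" by simp
      have "norm (u q - u p) \<le> ?E q" if q: "q \<in> S \<times> T" for q
      proof -
        obtain x y x0 y0 where [simp]: "q = (x, y)" "p = (x0, y0)" by (cases q, cases p)
        have "norm (u q - u p) \<le> norm (u (x, y) - u (x0, y)) + norm (u (x0, y) - u (x0, y0))"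
          using norm_triangle_ineq[of "u (x, y) - u (x0, y)" "u (x0, y) - u (x0, y0)"] by simp
        then show ?thesis using uh1[of x x0 y] uh2[of x0 y y0] p q by simp
      qed
      then have "\<forall>\<^sub>F q in ?F. norm (u q - u p) \<le> ?E q"
        by (auto simp: eventually_at_filter)
      from Lim_null_comparison[OF this E] show "(u \<longlongrightarrow> u p) ?F"
        by (rule LIM_zero_cancel)
    qed
    then have m: "u \<in> borel_measurable (lebesgue_on (S \<times> T))"
      using open_Times[OF S T] by (intro continuous_imp_measurable_on_sets_lebesgue) auto
    have "C * n \<ge> 0" using C n by simp
    from iterated_Holder_norm_le[OF m this ub uh12]
    show "act1 A g \<in> borel_measurable (lebesgue_on (S \<times> T)) \<and>
      iterated_Holder_norm \<alpha>1 \<alpha>2 S T (act1 A g) \<le> ennreal (2 * C * (\<Sum>i\<in>UNIV. N i))"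
      using m by (simp add: u_def n_def mult.assoc)
  qed (use C in auto)
qed

lemma Linf_norm_le_iterated_Holder_norm: "Linf_norm (S \<times> T) g \<le> iterated_Holder_norm \<alpha>1 \<alpha>2 S T g"
  by (simp add: iterated_Holder_norm_def add_increasing2)

text \<open>A slice of a general test function on the product is a test function on
  \<open>S\<close>, so the slice equation can be tested with it directly and integrated over
  \<open>y\<close>; no approximation by tensor products is involved.\<close>

lemma act1_solves_dbar:
  fixes S :: "'e::euclidean_space set" and T :: "'f::euclidean_space set"
    and A :: "('i::finite, 'e) form01 \<Rightarrow> 'e \<Rightarrow> complex" and g :: "('i, 'e \<times> 'f) form01"
  assumes S: "open S" "bounded S" and T: "open T" "bounded T" and \<alpha>1: "0 < \<alpha>1" and \<alpha>2: "0 < \<alpha>2"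
    and op: "bounded_operator_Linf_Holder \<alpha>1 S A" and solves: "solves_dbar L S A"
    and fin: "\<And>i. Linf_Holder_norm \<alpha>2 S T (g i) < \<infinity>"
    and closed: "dbar_closed (\<lambda>i c. (L i c, 0)) (S \<times> T) g"
  shows "dbar_solution (\<lambda>i c. (L i c, 0)) (S \<times> T) (act1 A g) g"
  unfolding dbar_solution_def weak_dbar_def
proof (intro allI conjI impI)
  define N where "N i = enn2real (Linf_Holder_norm \<alpha>2 S T (g i))" for i
  have N: "N i \<ge> 0" "Linf_Holder_norm \<alpha>2 S T (g i) \<le> ennreal (N i)" for i
    using fin[of i] by (auto simp: N_def)
  have ST: "open (S \<times> T)" "bounded (S \<times> T)"
    using S T by (auto intro: open_Times bounded_Times)
  obtain C where "iterated_Holder_norm \<alpha>1 \<alpha>2 S T (act1 A g) \<le> ennreal (C * (\<Sum>i\<in>UNIV. N i))"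
    using act1_estimates[OF S(1) T(1) \<alpha>1 \<alpha>2 op] N by metis
  from le_less_trans[OF order_trans[OF Linf_norm_le_iterated_Holder_norm this] ennreal_less_top]
  have u_fin: "Linf_norm (S \<times> T) (act1 A g) < \<infinity>" by simp
  have g_fin: "Linf_norm (S \<times> T) (g i) < \<infinity>" for i
    using le_less_trans[OF Linf_norm_le_Linf_Holder_norm fin] .
  fix i
  show "locally_integrable (S \<times> T) (act1 A g)" "locally_integrable (S \<times> T) (g i)"
    using ST by (auto intro!: Linf_norm_locally_integrable u_fin g_fin)
  fix \<Phi> assume \<Phi>: "test_function (S \<times> T) \<Phi>"
  have slice: "(LINT x|lebesgue_on S. act1 A g (x, y) * dbar_at (\<lambda>c. (L i c, 0)) \<Phi> (x, y)) =
      - (LINT x|lebesgue_on S. g i (x, y) * \<Phi> (x, y))" if y: "y \<in> T" for y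
  proof -
    have "Linf_form_norm S (\<lambda>i x. g i (x, y)) \<le> ennreal (\<Sum>i\<in>UNIV. N i)"
      by (intro Linf_form_norm_le Linf_Holder_norm_slices(1)[OF S(1) T(1) \<alpha>2 N] N y)
    moreover have "dbar_closed L S (\<lambda>i x. g i (x, y))"
      by (rule dbar_closed_slice[OF S T \<alpha>2 N closed y])
    ultimately have "dbar_solution L S (A (\<lambda>i x. g i (x, y))) (\<lambda>i x. g i (x, y))"
      using solves le_less_trans[OF _ ennreal_less_top] unfolding solves_dbar_def by auto
    then have "(LINT x|lebesgue_on S. A (\<lambda>i x. g i (x, y)) x * dbar_at (L i) (\<lambda>x. \<Phi> (x, y)) x) =
        - (LINT x|lebesgue_on S. g i (x, y) * \<Phi> (x, y))"
      using test_function_slice[OF \<Phi>] unfolding dbar_solution_def weak_dbar_def by blast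
    then show ?thesis
      by (simp add: act1_def dbar_at_slice test_function_differentiable[OF \<Phi>])
  qed
  have "(LINT z|lebesgue_on (S \<times> T). act1 A g z * dbar_at (\<lambda>c. (L i c, 0)) \<Phi> z) =
      (LINT y|lebesgue_on T. LINT x|lebesgue_on S. act1 A g (x, y) * dbar_at (\<lambda>c. (L i c, 0)) \<Phi> (x, y))"
    by (intro Fubini_lebesgue_on S T Linf_norm_mult_integrable[OF ST u_fin test_function_dbar_at[OF \<Phi>]])
  also have "\<dots> = (LINT y|lebesgue_on T. - (LINT x|lebesgue_on S. g i (x, y) * \<Phi> (x, y)))"
    by (rule Bochner_Integration.integral_cong) (simp_all add: slice)
  also have "\<dots> = - (LINT z|lebesgue_on (S \<times> T). g i z * \<Phi> z)"
    by (subst Fubini_lebesgue_on[OF S(1) T(1) Linf_norm_mult_integrable[OF ST g_fin \<Phi>]]) simp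
  finally show "(LINT z|lebesgue_on (S \<times> T). act1 A g z * dbar_at (\<lambda>c. (L i c, 0)) \<Phi> z) =
    - (LINT z|lebesgue_on (S \<times> T). g i z * \<Phi> z)" .
qed

section \<open>Transfer to the second factor by exchanging the variables\<close>

lemma test_integral_swap:
  fixes S :: "'e::euclidean_space set" and T :: "'f::euclidean_space set"
  assumes S: "open S" "bounded S" and T: "open T" "bounded T"
    and g: "Linf_norm (S \<times> T) g < \<infinity>" and \<Phi>: "test_function (S \<times> T) \<Phi>"
  shows "(LINT z|lebesgue_on (T \<times> S). g (prod.swap z) * \<Phi> (prod.swap z)) =
    (LINT z|lebesgue_on (S \<times> T). g z * \<Phi> z)"
proof -
  have "integrable (lebesgue_on (S \<times> T)) (\<lambda>z. g z * \<Phi> z)"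
    using S T by (intro Linf_norm_mult_integrable g) (auto intro: open_Times bounded_Times \<Phi>)
  from lebesgue_on_swap_integral[OF S(1) T(1) borel_measurable_integrable[OF this]]
  show ?thesis .
qed

lemma weak_dbar_swap:
  fixes S :: "'e::euclidean_space set" and T :: "'f::euclidean_space set"
  assumes S: "open S" "bounded S" and T: "open T" "bounded T"
    and u: "Linf_norm (S \<times> T) u < \<infinity>" and g: "Linf_norm (S \<times> T) g < \<infinity>"
    and weak: "weak_dbar L (S \<times> T) u g"
  shows "weak_dbar (\<lambda>c. prod.swap (L c)) (T \<times> S) (\<lambda>z. u (prod.swap z)) (\<lambda>z. g (prod.swap z))"
  unfolding weak_dbar_def
proof (intro conjI allI impI)
  have "T \<times> S \<in> sets lebesgue" using open_Times[OF T(1) S(1)] by auto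
  then show "locally_integrable (T \<times> S) (\<lambda>z. u (prod.swap z))" "locally_integrable (T \<times> S) (\<lambda>z. g (prod.swap z))"
    using u g by (auto intro!: Linf_norm_locally_integrable simp: Linf_norm_swap[OF S(1) T(1)])
  fix \<Psi> assume \<Psi>: "test_function (T \<times> S) \<Psi>"
  \<comment> \<open>The exchange is an involution, so each test function on
    \<open>T \<times> S\<close> arises from one on \<open>S \<times> T\<close>.\<close>
  define \<Phi> where "\<Phi> z = \<Psi> (prod.swap z)" for z
  have \<Phi>: "test_function (S \<times> T) \<Phi>"
    unfolding \<Phi>_def using test_function_swap[OF \<Psi>] .
  have \<Psi>_eq: "\<Psi> = (\<lambda>z. \<Phi> (prod.swap z))" by (simp add: \<Phi>_def)
  have "dbar_at (\<lambda>c. prod.swap (L c)) \<Psi> z = dbar_at L \<Phi> (prod.swap z)" for z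
    unfolding \<Psi>_eq by (rule dbar_at_swap[OF test_function_differentiable[OF \<Phi>]])
  then show "(LINT z|lebesgue_on (T \<times> S). u (prod.swap z) * dbar_at (\<lambda>c. prod.swap (L c)) \<Psi> z) =
      - (LINT z|lebesgue_on (T \<times> S). g (prod.swap z) * \<Psi> z)"
    using weak \<Phi> test_integral_swap[OF S T u test_function_dbar_at[OF \<Phi>], of L]
      test_integral_swap[OF S T g \<Phi>]
    by (simp add: weak_dbar_def \<Psi>_eq)
qed

lemma dbar_closed_swap:
  fixes S :: "'e::euclidean_space set" and T :: "'f::euclidean_space set"
  assumes S: "open S" "bounded S" and T: "open T" "bounded T"
    and g: "\<And>i. Linf_norm (S \<times> T) (g i) < \<infinity>"
    and closed: "dbar_closed L (S \<times> T) g"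
  shows "dbar_closed (\<lambda>i c. prod.swap (L i c)) (T \<times> S) (\<lambda>i z. g i (prod.swap z))"
  unfolding dbar_closed_def
proof (intro conjI allI impI)
  have "T \<times> S \<in> sets lebesgue" using open_Times[OF T(1) S(1)] by auto
  then show "locally_integrable (T \<times> S) (\<lambda>z. g i (prod.swap z))" for i
    using g by (auto intro!: Linf_norm_locally_integrable simp: Linf_norm_swap[OF S(1) T(1)])
  fix i j \<Psi> assume \<Psi>: "test_function (T \<times> S) \<Psi>"
  define \<Phi> where "\<Phi> z = \<Psi> (prod.swap z)" for z
  have \<Phi>: "test_function (S \<times> T) \<Phi>"
    unfolding \<Phi>_def using test_function_swap[OF \<Psi>] .
  have \<Psi>_eq: "\<Psi> = (\<lambda>z. \<Phi> (prod.swap z))" by (simp add: \<Phi>_def)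
  have *: "dbar_at (\<lambda>c. prod.swap (L i c)) \<Psi> z = dbar_at (L i) \<Phi> (prod.swap z)" for i z
    unfolding \<Psi>_eq by (rule dbar_at_swap[OF test_function_differentiable[OF \<Phi>]])
  show "(LINT z|lebesgue_on (T \<times> S). g i (prod.swap z) * dbar_at (\<lambda>c. prod.swap (L j c)) \<Psi> z) =
      (LINT z|lebesgue_on (T \<times> S). g j (prod.swap z) * dbar_at (\<lambda>c. prod.swap (L i c)) \<Psi> z)"
    unfolding * test_integral_swap[OF S T g test_function_dbar_at[OF \<Phi>]]
    using closed \<Phi> unfolding dbar_closed_def by blast
qed

lemma Holder_Linf_norm_swap:
  fixes S :: "'e::euclidean_space set" and T :: "'f::euclidean_space set"
  assumes "open S" "open T"
  shows "Holder_Linf_norm \<alpha> S T g = Linf_Holder_norm \<alpha> T S (\<lambda>z. g (prod.swap z))"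
  using Linf_norm_swap[OF assms, of g] by (simp add: Holder_Linf_norm_def Linf_Holder_norm_def)

text \<open>Exchanging the factors permutes the two middle terms of the mixed difference and leaves
  it unchanged.\<close>

lemma iterated_Holder_norm_swap_le:
  fixes S :: "'e::euclidean_space set" and T :: "'f::euclidean_space set"
  assumes "open S" "open T"
  shows "iterated_Holder_norm \<alpha>1 \<alpha>2 S T u \<le> iterated_Holder_norm \<alpha>2 \<alpha>1 T S (\<lambda>z. u (prod.swap z))"
  unfolding iterated_Holder_norm_def
proof (intro add_mono SUP_least)
  show "Linf_norm (S \<times> T) u \<le> Linf_norm (T \<times> S) (\<lambda>z. u (prod.swap z))"
    using Linf_norm_swap[OF assms, of u] by simp
  fix x x' y y' assume "x \<in> S" "x' \<in> S - {x}" "y \<in> T" "y' \<in> T - {y}"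
  then show "ennreal (norm (u (x, y) - u (x', y) - u (x, y') + u (x', y')) / (norm (x - x') powr \<alpha>1 * norm (y - y') powr \<alpha>2))
    \<le> (SUP y\<in>T. SUP y'\<in>T - {y}. SUP x\<in>S. SUP x'\<in>S - {x}. ennreal
        (norm (u (prod.swap (y, x)) - u (prod.swap (y', x)) - u (prod.swap (y, x')) + u (prod.swap (y', x')))
          / (norm (y - y') powr \<alpha>2 * norm (x - x') powr \<alpha>1)))"
    by (intro SUP_upper2[of y] SUP_upper2[of y'] SUP_upper2[of x] SUP_upper2[of x'])
       (auto intro!: eq_refl simp: algebra_simps)
qed

lemma act2_eq_act1_swap: "act2 A g = (\<lambda>z. act1 A (\<lambda>i z. g i (prod.swap z)) (prod.swap z))"
  by (auto simp: act1_def act2_def)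

lemma act2_estimates:
  fixes S :: "'e::euclidean_space set" and T :: "'f::euclidean_space set"
    and A :: "('i::finite, 'f) form01 \<Rightarrow> 'f \<Rightarrow> complex"
  assumes S: "open S" and T: "open T" and \<alpha>1: "0 < \<alpha>1" and \<alpha>2: "0 < \<alpha>2"
    and op: "bounded_operator_Linf_Holder \<alpha>2 T A"
  obtains C where "C \<ge> 0"
    "\<And>(g :: ('i, 'e \<times> 'f) form01) N. \<lbrakk>\<And>i. N i \<ge> 0; \<And>i. Holder_Linf_norm \<alpha>1 S T (g i) \<le> ennreal (N i)\<rbrakk> \<Longrightarrow>
      iterated_Holder_norm \<alpha>1 \<alpha>2 S T (act2 A g) \<le> ennreal (C * (\<Sum>i\<in>UNIV. N i))"
proof -
  obtain C where C: "C \<ge> 0"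
    "\<And>(g :: ('i, 'f \<times> 'e) form01) N. \<lbrakk>\<And>i. N i \<ge> 0; \<And>i. Linf_Holder_norm \<alpha>1 T S (g i) \<le> ennreal (N i)\<rbrakk> \<Longrightarrow>
      iterated_Holder_norm \<alpha>2 \<alpha>1 T S (act1 A g) \<le> ennreal (C * (\<Sum>i\<in>UNIV. N i))"
    using act1_estimates[OF T S \<alpha>2 \<alpha>1 op] by metis
  show ?thesis
  proof (rule that[OF C(1)])
    fix g :: "('i, 'e \<times> 'f) form01" and N
    assume N: "\<And>i. N i \<ge> 0" "\<And>i. Holder_Linf_norm \<alpha>1 S T (g i) \<le> ennreal (N i)"
    show "iterated_Holder_norm \<alpha>1 \<alpha>2 S T (act2 A g) \<le> ennreal (C * (\<Sum>i\<in>UNIV. N i))"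
    proof -
      have "iterated_Holder_norm \<alpha>2 \<alpha>1 T S (act1 A (\<lambda>i z. g i (prod.swap z))) \<le> ennreal (C * (\<Sum>i\<in>UNIV. N i))"
        using N by (intro C(2)) (simp_all add: Holder_Linf_norm_swap[OF S T])
      then show ?thesis
        using iterated_Holder_norm_swap_le[OF S T, of \<alpha>1 \<alpha>2 "act2 A g"]
        by (simp add: act2_eq_act1_swap)
    qed
  qed
qed

text \<open>\<open>act1_solves_dbar\<close> is formulated for arbitrary Euclidean spaces and
  directions \<open>L\<close>, so it can be read with the factors exchanged and carried back by the
  swap lemmas.\<close>

lemma act2_solves_dbar:
  fixes S :: "'e::euclidean_space set" and T :: "'f::euclidean_space set"
    and A :: "('i::finite, 'f) form01 \<Rightarrow> 'f \<Rightarrow> complex" and g :: "('i, 'e \<times> 'f) form01"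
  assumes S: "open S" "bounded S" and T: "open T" "bounded T" and \<alpha>1: "0 < \<alpha>1" and \<alpha>2: "0 < \<alpha>2"
    and op: "bounded_operator_Linf_Holder \<alpha>2 T A" and solves: "solves_dbar L T A"
    and fin: "\<And>i. Holder_Linf_norm \<alpha>1 S T (g i) < \<infinity>"
    and closed: "dbar_closed (\<lambda>i c. (0, L i c)) (S \<times> T) g"
  shows "dbar_solution (\<lambda>i c. (0, L i c)) (S \<times> T) (act2 A g) g"
proof -
  define h where "h i z = g i (prod.swap z)" for i z
  have h_fin: "Linf_Holder_norm \<alpha>1 T S (h i) < \<infinity>" for i
    using fin[of i] by (simp add: Holder_Linf_norm_swap[OF S(1) T(1)] h_def[abs_def])
  have g_fin: "Linf_norm (S \<times> T) (g i) < \<infinity>" for i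
    using le_less_trans[OF Linf_norm_le_Linf_Holder_norm h_fin[of i]] Linf_norm_swap[OF S(1) T(1), of "g i"]
    by (simp add: h_def[abs_def])
  have h_closed: "dbar_closed (\<lambda>i c. (L i c, 0)) (T \<times> S) h"
    using dbar_closed_swap[OF S T g_fin closed] by (simp add: h_def[abs_def])
  have sol: "dbar_solution (\<lambda>i c. (L i c, 0)) (T \<times> S) (act1 A h) h"
    by (rule act1_solves_dbar[OF T S \<alpha>2 \<alpha>1 op solves h_fin h_closed])
  define N where "N i = enn2real (Linf_Holder_norm \<alpha>1 T S (h i))" for i
  have N: "N i \<ge> 0" "Linf_Holder_norm \<alpha>1 T S (h i) \<le> ennreal (N i)" for i
    using h_fin[of i] by (auto simp: N_def)
  obtain C where "iterated_Holder_norm \<alpha>2 \<alpha>1 T S (act1 A h) \<le> ennreal (C * (\<Sum>i\<in>UNIV. N i))"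
    using act1_estimates[OF T(1) S(1) \<alpha>2 \<alpha>1 op] N by metis
  from le_less_trans[OF order_trans[OF Linf_norm_le_iterated_Holder_norm this] ennreal_less_top]
  have u_fin: "Linf_norm (T \<times> S) (act1 A h) < \<infinity>" by simp
  have "Linf_norm (T \<times> S) (h i) < \<infinity>" for i
    using le_less_trans[OF Linf_norm_le_Linf_Holder_norm h_fin] .
  then have "weak_dbar (\<lambda>c. prod.swap (L i c, 0)) (S \<times> T) (\<lambda>z. act1 A h (prod.swap z)) (\<lambda>z. h i (prod.swap z))" for i
    using sol unfolding dbar_solution_def by (intro weak_dbar_swap[OF T S u_fin]) auto
  moreover have "act2 A g = (\<lambda>z. act1 A h (prod.swap z))"
    by (simp add: act2_eq_act1_swap h_def[abs_def])
  ultimately show ?thesis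
    unfolding dbar_solution_def by (simp add: h_def[abs_def])
qed

section \<open>Sums and representatives\<close>

lemma iterated_Holder_norm_add:
  "iterated_Holder_norm \<alpha>1 \<alpha>2 S T (\<lambda>z. u z + v z) \<le>
   iterated_Holder_norm \<alpha>1 \<alpha>2 S T u + iterated_Holder_norm \<alpha>1 \<alpha>2 S T v"
proof -
  define Q where "Q u x x' y y' = ennreal (norm (u (x, y) - u (x', y) - u (x, y') + u (x', y')) /
      (norm (x - x') powr \<alpha>1 * norm (y - y') powr \<alpha>2))" for u :: "'a \<times> 'b \<Rightarrow> complex" and x x' y y'
  define H where "H u = (SUP x\<in>S. SUP x'\<in>S - {x}. SUP y\<in>T. SUP y'\<in>T - {y}. Q u x x' y y')" for u
  have it: "iterated_Holder_norm \<alpha>1 \<alpha>2 S T u = Linf_norm (S \<times> T) u + H u" for u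
    by (simp add: iterated_Holder_norm_def H_def Q_def)
  have Q_add: "Q (\<lambda>z. u z + v z) x x' y y' \<le> Q u x x' y y' + Q v x x' y y'" for x x' y y'
  proof -
    have "norm (u (x, y) + v (x, y) - (u (x', y) + v (x', y)) - (u (x, y') + v (x, y')) + (u (x', y') + v (x', y')))
        \<le> norm (u (x, y) - u (x', y) - u (x, y') + u (x', y')) + norm (v (x, y) - v (x', y) - v (x, y') + v (x', y'))"
      by (rule order_trans[OF eq_refl norm_triangle_ineq]) (simp add: algebra_simps)
    then show ?thesis
      unfolding Q_def by (simp add: divide_right_mono flip: ennreal_plus add_divide_distrib)
  qed
  have "H (\<lambda>z. u z + v z) \<le> H u + H v"
    unfolding H_def[of "\<lambda>z. u z + v z"]
  proof (intro SUP_least order_trans[OF Q_add] add_mono)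
    show "Q u x x' y y' \<le> H u" if "x \<in> S" "x' \<in> S - {x}" "y \<in> T" "y' \<in> T - {y}" for u x x' y y'
      unfolding H_def using that
      by (intro SUP_upper2[of x] SUP_upper2[of x'] SUP_upper2[of y] SUP_upper2[of y']) auto
    then show "Q v x x' y y' \<le> H v" if "x \<in> S" "x' \<in> S - {x}" "y \<in> T" "y' \<in> T - {y}" for x x' y y'
      using that .
  qed
  from add_mono[OF Linf_norm_add[of "S \<times> T" u v] this] show ?thesis
    unfolding it by (simp add: ac_simps)
qed

lemma Holder_Linf_norm_diff:
  "Holder_Linf_norm \<alpha> S T (\<lambda>z. u z - v z) \<le> Holder_Linf_norm \<alpha> S T u + Holder_Linf_norm \<alpha> S T v"
proof -
  define Q where "Q u x x' = Linf_norm T (\<lambda>y. u (x, y) - u (x', y)) / ennreal (norm (x - x') powr \<alpha>)"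
    for u :: "'a \<times> 'b \<Rightarrow> complex" and x x'
  define H where "H u = (SUP x\<in>S. SUP x'\<in>S - {x}. Q u x x')" for u
  have it: "Holder_Linf_norm \<alpha> S T u = Linf_norm (S \<times> T) u + H u" for u
    by (simp add: Holder_Linf_norm_def H_def Q_def)
  have Q_diff: "Q (\<lambda>z. u z - v z) x x' \<le> Q u x x' + Q v x x'" for x x'
  proof -
    have "Linf_norm T (\<lambda>y. u (x, y) - v (x, y) - (u (x', y) - v (x', y)))
        = Linf_norm T (\<lambda>y. (u (x, y) - u (x', y)) - (v (x, y) - v (x', y)))"
      by (simp add: algebra_simps)
    also have "\<dots> \<le> Linf_norm T (\<lambda>y. u (x, y) - u (x', y)) + Linf_norm T (\<lambda>y. v (x, y) - v (x', y))"
      by (rule Linf_norm_diff)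
    finally show ?thesis
      unfolding Q_def by (simp add: divide_right_mono_ennreal flip: add_divide_distrib_ennreal)
  qed
  have "H (\<lambda>z. u z - v z) \<le> H u + H v"
    unfolding H_def[of "\<lambda>z. u z - v z"]
  proof (intro SUP_least order_trans[OF Q_diff] add_mono)
    show "Q u x x' \<le> H u" if "x \<in> S" "x' \<in> S - {x}" for u x x'
      unfolding H_def using that by (intro SUP_upper2[of x] SUP_upper2[of x']) auto
    then show "Q v x x' \<le> H v" if "x \<in> S" "x' \<in> S - {x}" for x x'
      using that .
  qed
  from add_mono[OF Linf_norm_diff[of "S \<times> T" u v] this] show ?thesis
    unfolding it by (simp add: ac_simps)
qed

lemma Linf_norm_le_Holder_Linf_norm: "Linf_norm (S \<times> T) g \<le> Holder_Linf_norm \<alpha> S T g"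
  by (simp add: Holder_Linf_norm_def add_increasing2)

section \<open>Coefficients that are merely bounded\<close>

text \<open>Values of the Borel representative beyond \<open>M\<close> are set to 0. On
  \<open>S\<close> this happens only on a null set, since there the representative equals
  \<open>h\<close>, which is bounded by \<open>M\<close>, almost everywhere.\<close>

lemma bounded_borel_representative:
  fixes S :: "'e::euclidean_space set"
  assumes S: "S \<in> sets lebesgue" and h: "Linf_norm S h \<le> ennreal M" and M: "M \<ge> 0"
  obtains h' where "h' \<in> borel_measurable borel" "\<And>x. norm (h' x) \<le> M" "AE x in lebesgue_on S. h x = h' x"
proof -
  have h: "h \<in> borel_measurable (lebesgue_on S)" "AE x in lebesgue_on S. norm (h x) \<le> M"
    using h Linf_norm_le_iff[OF M] by auto
  obtain G where G: "G \<in> borel_measurable borel" "AE x in lebesgue. indicator S x *\<^sub>R h x = G x"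
    using lebesgue_on_borel_representative[OF S h(1)] .
  define h' where "h' x = (if norm (G x) \<le> M then G x else 0)" for x
  show ?thesis
  proof (rule that)
    show "h' \<in> borel_measurable borel"
      unfolding h'_def using G(1) by measurable
    show "norm (h' x) \<le> M" for x using M by (simp add: h'_def)
    have "AE x in lebesgue. x \<in> S \<longrightarrow> norm (h x) \<le> M"
      using h(2) S by (simp add: AE_lebesgue_on_iff)
    then have "AE x in lebesgue. x \<in> S \<longrightarrow> h x = h' x"
      using G(2) by eventually_elim (auto simp: h'_def)
    then show "AE x in lebesgue_on S. h x = h' x"
      using S by (simp add: AE_lebesgue_on_iff)
  qed
qed

lemma Linf_norm_borel_le:
  fixes S :: "'e::euclidean_space set"
  assumes h: "h \<in> borel_measurable borel" and M: "\<And>x. norm (h x) \<le> M" "M \<ge> 0"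
  shows "Linf_norm S h \<le> ennreal M"
proof -
  have "h \<in> borel_measurable lebesgue" using h by (simp add: measurable_completion)
  then have "h \<in> borel_measurable (lebesgue_on S)" by (rule measurable_restrict_space1)
  then show ?thesis using M(1) by (simp add: Linf_norm_le_iff[OF M(2)])
qed

text \<open>Used to replace the mixed coefficients by Borel representatives, and to replace the
  image of the zero form by 0.\<close>

lemma weak_dbar_cong_AE:
  fixes S :: "'e::euclidean_space set"
  assumes S: "open S" and weak: "weak_dbar L S g h" and h': "Linf_norm S h' < \<infinity>"
    and ae: "AE x in lebesgue_on S. h x = h' x"
  shows "weak_dbar L S g h'"
  unfolding weak_dbar_def
proof (intro conjI allI impI)
  show "locally_integrable S g" using weak by (simp add: weak_dbar_def)
  show "locally_integrable S h'" using S by (intro Linf_norm_locally_integrable h') auto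
  fix \<phi> assume \<phi>: "test_function S \<phi>"
  have h: "h \<in> borel_measurable (lebesgue_on S)"
    using weak locally_integrable_measurable[OF S] by (simp add: weak_dbar_def)
  have h'_meas: "h' \<in> borel_measurable (lebesgue_on S)"
    using h' by (rule Linf_norm_finiteE)
  have \<phi>_meas: "\<phi> \<in> borel_measurable (lebesgue_on S)"
    using S \<phi> by (intro continuous_imp_measurable_on_sets_lebesgue)
      (auto intro: continuous_on_subset[OF test_function_continuous])
  have "(LINT x|lebesgue_on S. h x * \<phi> x) = (LINT x|lebesgue_on S. h' x * \<phi> x)"
    using ae h h'_meas \<phi>_meas by (intro integral_cong_AE) (auto elim!: eventually_mono)
  then show "(LINT x|lebesgue_on S. g x * dbar_at L \<phi> x) = - (LINT x|lebesgue_on S. h' x * \<phi> x)"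
    using weak \<phi> by (simp add: weak_dbar_def)
qed

lemma weak_dbar_add:
  fixes S :: "'e::euclidean_space set"
  assumes S: "open S" "bounded S"
    and fin: "Linf_norm S u < \<infinity>" "Linf_norm S v < \<infinity>" "Linf_norm S f < \<infinity>" "Linf_norm S g < \<infinity>"
    and weak: "weak_dbar L S u f" "weak_dbar L S v g"
  shows "weak_dbar L S (\<lambda>x. u x + v x) (\<lambda>x. f x + g x)"
  unfolding weak_dbar_def
proof (intro conjI allI impI)
  show "locally_integrable S (\<lambda>x. u x + v x)" "locally_integrable S (\<lambda>x. f x + g x)"
    using weak by (auto simp: weak_dbar_def locally_integrable_def)
  fix \<phi> assume \<phi>: "test_function S \<phi>"
  note int = Linf_norm_mult_integrable[OF S _ \<phi>] Linf_norm_mult_integrable[OF S _ test_function_dbar_at[OF \<phi>]]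
  show "(LINT x|lebesgue_on S. (u x + v x) * dbar_at L \<phi> x) = - (LINT x|lebesgue_on S. (f x + g x) * \<phi> x)"
    using weak \<phi> int fin by (simp add: weak_dbar_def distrib_right)
qed

text \<open>The coefficients carry no continuity in \<open>y\<close>, so the estimate uses only what
  \<open>A\<close> provides in \<open>x\<close>, uniformly over all \<open>y\<close>. Joint
  measurability is assumed because slicewise bounds cannot yield it; in the application it comes
  from commutation.\<close>

lemma act1_Holder_Linf_norm_le:
  fixes S :: "'e::euclidean_space set" and T :: "'f::euclidean_space set"
    and A :: "('i::finite, 'e) form01 \<Rightarrow> 'e \<Rightarrow> complex"
  assumes S: "open S" and T: "open T" and \<alpha>: "0 < \<alpha>"
    and op: "bounded_operator_Linf_Holder \<alpha> S A"
  obtains C where "C \<ge> 0"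
    "\<And>(h :: ('i, 'e \<times> 'f) form01) N. \<lbrakk>\<And>i. N i \<ge> 0; \<And>i. h i \<in> borel_measurable borel; \<And>i z. norm (h i z) \<le> N i;
       act1 A h \<in> borel_measurable (lebesgue_on (S \<times> T))\<rbrakk> \<Longrightarrow>
      Holder_Linf_norm \<alpha> S T (act1 A h) \<le> ennreal (C * (\<Sum>i\<in>UNIV. N i))"
proof -
  obtain C where C: "C \<ge> 0"
    and Cb: "\<And>\<beta> M z. \<lbrakk>M \<ge> 0; Linf_form_norm S \<beta> \<le> ennreal M; z \<in> S\<rbrakk> \<Longrightarrow> norm (A \<beta> z) \<le> C * M"
    and Ch: "\<And>\<beta> M z w. \<lbrakk>M \<ge> 0; Linf_form_norm S \<beta> \<le> ennreal M; z \<in> S; w \<in> S\<rbrakk> \<Longrightarrow>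
       norm (A \<beta> z - A \<beta> w) \<le> C * M * norm (z - w) powr \<alpha>"
    using bounded_operator_bounds[OF op S \<alpha>] by blast
  show ?thesis
  proof (rule that[of "2 * C"])
    fix h :: "('i, 'e \<times> 'f) form01" and N
    assume N: "\<And>i. N i \<ge> 0" and h: "\<And>i. h i \<in> borel_measurable borel" "\<And>i z. norm (h i z) \<le> N i"
      and m: "act1 A h \<in> borel_measurable (lebesgue_on (S \<times> T))"
    define n where "n = (\<Sum>i\<in>UNIV. N i)"
    define w where "w = act1 A h"
    have n: "n \<ge> 0" unfolding n_def by (intro sum_nonneg N)
    have Cn: "C * n \<ge> 0" using C n by simp
    have form: "Linf_form_norm S (\<lambda>i x. h i (x, y)) \<le> ennreal n" for y
      unfolding n_def
    proof (intro Linf_form_norm_le N Linf_norm_borel_le h)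
      show "(\<lambda>x. h i (x, y)) \<in> borel_measurable borel" for i
        using h(1) by (rule measurable_compose[rotated]) (simp add: borel_measurable_Pair)
    qed
    have wb: "norm (w (x, y)) \<le> C * n" if "x \<in> S" for x y
      unfolding w_def act1_def using that by (auto intro!: Cb n form)
    have wh: "norm (w (x, y) - w (x', y)) \<le> C * n * norm (x - x') powr \<alpha>" if "x \<in> S" "x' \<in> S" for x x' y
      unfolding w_def act1_def using that by (auto intro!: Ch n form)
    \<comment> \<open>\<open>Holder_Linf_norm\<close> asks for measurable differences at every pair
      \<open>x\<close>, \<open>x'\<close>. Joint measurability gives it for almost every
      \<open>x\<close>, and the Hoelder bound makes the remaining slices pointwise limits of good
      ones.\<close>
    have meas: "(\<lambda>y. w (x, y)) \<in> borel_measurable (lebesgue_on T)" if x: "x \<in> S" for x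
    proof -
      have "AE x in lebesgue_on S. (\<lambda>y. w (x, y)) \<in> borel_measurable (lebesgue_on T)"
        using measurable_lebesgue_on_slice[OF T S lebesgue_on_swap_measurable[OF S T m]]
        by (simp add: w_def)
      then obtain X where X: "\<And>n. X n \<in> S" "\<And>n. (\<lambda>y. w (X n, y)) \<in> borel_measurable (lebesgue_on T)" "X \<longlonglongrightarrow> x"
        by (rule AE_lebesgue_on_open_approx[OF S _ x]) (rule that)
      have "(\<lambda>n. norm (X n - x)) \<longlonglongrightarrow> 0"
        using X(3) by (simp add: LIM_zero tendsto_norm_zero)
      then have "(\<lambda>n. norm (X n - x) powr \<alpha>) \<longlonglongrightarrow> 0"
        using \<alpha> by (intro tendsto_zero_powrI[where b=\<alpha>]) auto
      then have lim: "(\<lambda>k. C * n * norm (X k - x) powr \<alpha>) \<longlonglongrightarrow> 0"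
        by (rule tendsto_mult_right_zero)
      have "(\<lambda>n. w (X n, y)) \<longlonglongrightarrow> w (x, y)" for y
      proof (rule LIM_zero_cancel, rule Lim_null_comparison[OF _ lim])
        show "\<forall>\<^sub>F k in sequentially. norm (w (X k, y) - w (x, y)) \<le> C * n * norm (X k - x) powr \<alpha>"
          using wh X(1) x by (intro always_eventually) auto
      qed
      then show ?thesis
        by (intro borel_measurable_LIMSEQ_metric[OF X(2)])
    qed
    have 1: "Linf_norm (S \<times> T) w \<le> ennreal (C * n)"
      using m wb by (subst Linf_norm_le_iff[OF Cn]) (auto simp: w_def intro!: AE_I2)
    have 2: "Linf_norm T (\<lambda>y. w (x, y) - w (x', y)) / ennreal (norm (x - x') powr \<alpha>) \<le> ennreal (C * n)"
      if "x \<in> S" "x' \<in> S - {x}" for x x'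
    proof -
      let ?r = "norm (x - x') powr \<alpha>"
      have r: "?r > 0" using that by auto
      have "Linf_norm T (\<lambda>y. w (x, y) - w (x', y)) \<le> ennreal (C * n * ?r)"
        using that Cn r wh meas by (subst Linf_norm_le_iff) (auto intro!: AE_I2)
      then have "Linf_norm T (\<lambda>y. w (x, y) - w (x', y)) / ennreal ?r \<le> ennreal (C * n * ?r) / ennreal ?r"
        by (rule divide_right_mono_ennreal)
      also have "\<dots> = ennreal (C * n)"
        using r Cn by (subst divide_ennreal) auto
      finally show ?thesis .
    qed
    have "Holder_Linf_norm \<alpha> S T w \<le> ennreal (C * n) + ennreal (C * n)"
      unfolding Holder_Linf_norm_def by (intro add_mono 1 SUP_least 2)
    then show "Holder_Linf_norm \<alpha> S T (act1 A h) \<le> ennreal (2 * C * (\<Sum>i\<in>UNIV. N i))"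
      using Cn by (simp add: w_def n_def mult.assoc flip: ennreal_plus)
  qed (use C in auto)
qed

section \<open>The solution on the product\<close>

lemma prod_axis_eq:
  "prod_axis (Inl i) = (\<lambda>c. (axis i c, 0))" "prod_axis (Inr j) = (\<lambda>c. (0, axis j c))"
  by auto

text \<open>Here the solution may depend on the representative \<open>f12\<close> as well as on
  \<open>f\<close>; a solution that depends on \<open>f\<close> alone is selected in the
  theorem.\<close>

lemma dbar_solution_exists:
  fixes D1 :: "(complex ^ 'a) set" and D2 :: "(complex ^ 'b) set"
    and T1 :: "('a, complex ^ 'a) form01 \<Rightarrow> complex ^ 'a \<Rightarrow> complex"
    and T2 :: "('b, complex ^ 'b) form01 \<Rightarrow> complex ^ 'b \<Rightarrow> complex"
  assumes D1: "open D1" "bounded D1" and D2: "open D2" "bounded D2"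
    and \<alpha>1: "0 < \<alpha>1" and \<alpha>2: "0 < \<alpha>2"
    and op1: "bounded_operator_Linf_Holder \<alpha>1 D1 T1" and solves1: "solves_dbar axis D1 T1"
    and comm1: "\<And>m :: 'b. commutes_dbar (prod_axis (Inr m)) (D1 \<times> D2) (act1 T1)"
    and op2: "bounded_operator_Linf_Holder \<alpha>2 D2 T2" and solves2: "solves_dbar axis D2 T2"
    and comm2: "\<And>m :: 'a. commutes_dbar (prod_axis (Inl m)) (D1 \<times> D2) (act2 T2)"
  shows "\<exists>C\<ge>0::real. \<forall>f f12.
      dbar_closed prod_axis (D1 \<times> D2) f \<and>
      (\<forall>m m'. weak_dbar (prod_axis (Inr m')) (D1 \<times> D2) (f (Inl m)) (f12 m m')) \<and>
      (\<forall>m m'. Linf_norm (D1 \<times> D2) (f12 m m') < \<infinity>) \<and>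
      (\<forall>m. Linf_Holder_norm \<alpha>2 D1 D2 (f (Inl m)) < \<infinity>) \<and>
      (\<forall>m. Holder_Linf_norm \<alpha>1 D1 D2 (f (Inr m)) < \<infinity>) \<longrightarrow>
      (\<exists>u. dbar_solution prod_axis (D1 \<times> D2) u f \<and>
        iterated_Holder_norm \<alpha>1 \<alpha>2 D1 D2 u \<le> ennreal C *
          ((\<Sum>m\<in>UNIV. Linf_Holder_norm \<alpha>2 D1 D2 (f (Inl m)))
           + (\<Sum>m\<in>UNIV. Holder_Linf_norm \<alpha>1 D1 D2 (f (Inr m)))
           + (\<Sum>m\<in>UNIV. \<Sum>m'\<in>UNIV. Linf_norm (D1 \<times> D2) (f12 m m'))))"
proof -
  let ?D = "D1 \<times> D2"
  have D: "open ?D" "bounded ?D"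
    using D1 D2 by (auto intro: open_Times bounded_Times)
  have D_sets: "?D \<in> sets lebesgue" using D by auto
  obtain C1 where C1: "C1 \<ge> 0"
    and est1: "\<And>(g :: ('a, (complex ^ 'a) \<times> (complex ^ 'b)) form01) N.
      \<lbrakk>\<And>i. N i \<ge> 0; \<And>i. Linf_Holder_norm \<alpha>2 D1 D2 (g i) \<le> ennreal (N i)\<rbrakk> \<Longrightarrow>
      act1 T1 g \<in> borel_measurable (lebesgue_on ?D) \<and>
      iterated_Holder_norm \<alpha>1 \<alpha>2 D1 D2 (act1 T1 g) \<le> ennreal (C1 * (\<Sum>i\<in>UNIV. N i))"
    using act1_estimates[OF D1(1) D2(1) \<alpha>1 \<alpha>2 op1] by blast
  obtain C2 where C2: "C2 \<ge> 0"
    and est2: "\<And>(g :: ('b, (complex ^ 'a) \<times> (complex ^ 'b)) form01) N.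
      \<lbrakk>\<And>i. N i \<ge> 0; \<And>i. Holder_Linf_norm \<alpha>1 D1 D2 (g i) \<le> ennreal (N i)\<rbrakk> \<Longrightarrow>
      iterated_Holder_norm \<alpha>1 \<alpha>2 D1 D2 (act2 T2 g) \<le> ennreal (C2 * (\<Sum>i\<in>UNIV. N i))"
    using act2_estimates[OF D1(1) D2(1) \<alpha>1 \<alpha>2 op2] by blast
  obtain C3 where C3: "C3 \<ge> 0"
    and est3: "\<And>(h :: ('a, (complex ^ 'a) \<times> (complex ^ 'b)) form01) N.
      \<lbrakk>\<And>i. N i \<ge> 0; \<And>i. h i \<in> borel_measurable borel; \<And>i z. norm (h i z) \<le> N i;
       act1 T1 h \<in> borel_measurable (lebesgue_on ?D)\<rbrakk> \<Longrightarrow>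
      Holder_Linf_norm \<alpha>1 D1 D2 (act1 T1 h) \<le> ennreal (C3 * (\<Sum>i\<in>UNIV. N i))"
    using act1_Holder_Linf_norm_le[OF D1(1) D2(1) \<alpha>1 op1] by blast
  \<comment> \<open>The three summands are the costs of T1 f_1, of T2 f_2 and of T2 T1 f_12.\<close>
  define C where "C = C1 + C2 + C2 * C3"
  show ?thesis
  proof (intro exI[of _ C] conjI allI impI)
    show "C \<ge> 0" using C1 C2 C3 by (simp add: C_def)
    fix f :: "('a + 'b, (complex ^ 'a) \<times> (complex ^ 'b)) form01"
      and f12 :: "'a \<Rightarrow> 'b \<Rightarrow> (complex ^ 'a) \<times> (complex ^ 'b) \<Rightarrow> complex"
    assume "dbar_closed prod_axis ?D f \<and>
      (\<forall>m m'. weak_dbar (prod_axis (Inr m')) ?D (f (Inl m)) (f12 m m')) \<and>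
      (\<forall>m m'. Linf_norm ?D (f12 m m') < \<infinity>) \<and>
      (\<forall>m. Linf_Holder_norm \<alpha>2 D1 D2 (f (Inl m)) < \<infinity>) \<and>
      (\<forall>m. Holder_Linf_norm \<alpha>1 D1 D2 (f (Inr m)) < \<infinity>)"
    then have closed: "dbar_closed prod_axis ?D f"
      and weak12: "\<And>m m'. weak_dbar (prod_axis (Inr m')) ?D (f (Inl m)) (f12 m m')"
      and fin12: "\<And>m m'. Linf_norm ?D (f12 m m') < \<infinity>"
      and fin1: "\<And>m. Linf_Holder_norm \<alpha>2 D1 D2 (f (Inl m)) < \<infinity>"
      and fin2: "\<And>m. Holder_Linf_norm \<alpha>1 D1 D2 (f (Inr m)) < \<infinity>"
      by auto
    define n1 where "n1 m = enn2real (Linf_Holder_norm \<alpha>2 D1 D2 (f (Inl m)))" for m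
    define n2 where "n2 m = enn2real (Holder_Linf_norm \<alpha>1 D1 D2 (f (Inr m)))" for m
    define n12 where "n12 m m' = enn2real (Linf_norm ?D (f12 m m'))" for m m'
    have nonneg: "n1 m \<ge> 0" "n2 m' \<ge> 0" "n12 m m' \<ge> 0" for m m'
      by (simp_all add: n1_def n2_def n12_def)
    have n_eq: "Linf_Holder_norm \<alpha>2 D1 D2 (f (Inl m)) = ennreal (n1 m)"
      "Holder_Linf_norm \<alpha>1 D1 D2 (f (Inr m')) = ennreal (n2 m')"
      "Linf_norm ?D (f12 m m') = ennreal (n12 m m')" for m m'
      using fin1[of m] fin2[of m'] fin12[of m m'] by (simp_all add: n1_def n2_def n12_def)
    have f_fin: "Linf_norm ?D (f i) < \<infinity>" for i
      using le_less_trans[OF Linf_norm_le_Linf_Holder_norm fin1]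
        le_less_trans[OF Linf_norm_le_Holder_Linf_norm fin2] by (cases i) auto

    \<comment> \<open>A Borel representative bounded everywhere has no exceptional slices.\<close>
    define good where "good m m' h \<longleftrightarrow> h \<in> borel_measurable borel \<and> (\<forall>z. norm (h z) \<le> n12 m m') \<and>
      (AE z in lebesgue_on ?D. f12 m m' z = h z)" for m m' h
    have "\<exists>h. good m m' h" for m m'
      unfolding good_def
      by (rule bounded_borel_representative[OF D_sets eq_refl[OF n_eq(3)[of m m']] nonneg(3)]) blast
    then obtain h where "\<And>m m'. good m m' (h m m')" by metis
    then have h: "\<And>m m'. h m m' \<in> borel_measurable borel" "\<And>m m' z. norm (h m m' z) \<le> n12 m m'"
      "\<And>m m'. AE z in lebesgue_on ?D. f12 m m' z = h m m' z"
      unfolding good_def by auto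
    have h_le: "Linf_norm ?D (h m m') \<le> ennreal (n12 m m')" for m m'
      by (rule Linf_norm_borel_le[OF h(1,2) nonneg(3)])
    have h_fin: "Linf_norm ?D (h m m') < \<infinity>" for m m'
      using le_less_trans[OF h_le ennreal_less_top] by simp
    have weak_h: "weak_dbar (prod_axis (Inr m')) ?D (f (Inl m)) (h m m')" for m m'
      by (rule weak_dbar_cong_AE[OF D(1) weak12 h_fin h(3)])

    define v where "v = act1 T1 (\<lambda>m. f (Inl m))"
    have v_est: "iterated_Holder_norm \<alpha>1 \<alpha>2 D1 D2 v \<le> ennreal (C1 * (\<Sum>m\<in>UNIV. n1 m))"
      using est1[of n1 "\<lambda>m. f (Inl m)"] nonneg(1) n_eq(1) unfolding v_def by simp
    from le_less_trans[OF order_trans[OF Linf_norm_le_iterated_Holder_norm v_est] ennreal_less_top]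
    have v_fin: "Linf_norm ?D v < \<infinity>" by simp
    have "dbar_closed (\<lambda>i c. (axis i c, 0)) ?D (\<lambda>m. f (Inl m))"
      using closed unfolding dbar_closed_def prod_axis_eq(1)[symmetric] by blast
    then have "dbar_solution (\<lambda>i c. (axis i c, 0)) ?D v (\<lambda>m. f (Inl m))"
      unfolding v_def by (intro act1_solves_dbar[OF D1 D2 \<alpha>1 \<alpha>2 op1 solves1] fin1)
    then have v1: "weak_dbar (prod_axis (Inl m)) ?D v (f (Inl m))" for m
      unfolding dbar_solution_def prod_axis_eq by blast

    \<comment> \<open>For fixed \<open>m'\<close> the mixed coefficients form a (0,1)-form in the
      first variables. With the Borel representatives all of its slices are bounded and
      measurable.\<close>
    define w where "w m' = act1 T1 (\<lambda>m. h m m')" for m'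
    have v2: "weak_dbar (prod_axis (Inr m')) ?D v (w m')" for m'
    proof -
      have "Linf_form_norm ?D (\<lambda>m. f (Inl m)) < \<infinity>" "Linf_form_norm ?D (\<lambda>m. h m m') < \<infinity>"
        using f_fin h_fin by (simp_all add: Linf_form_norm_def)
      then show ?thesis
        using comm1[of m'] weak_h unfolding commutes_dbar_def v_def w_def by blast
    qed
    have w_est: "Holder_Linf_norm \<alpha>1 D1 D2 (w m') \<le> ennreal (C3 * (\<Sum>m\<in>UNIV. n12 m m'))" for m'
    proof -
      \<comment> \<open>Commutation is the source of joint measurability: it exhibits
        \<open>w m'\<close> as a weak derivative, hence as locally integrable.\<close>
      have "w m' \<in> borel_measurable (lebesgue_on ?D)"
        using v2[of m'] locally_integrable_measurable[OF D(1)] unfolding weak_dbar_def by blast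
      then show ?thesis unfolding w_def using nonneg h by (intro est3) auto
    qed
    from le_less_trans[OF order_trans[OF Linf_norm_le_Holder_Linf_norm w_est] ennreal_less_top]
    have w_fin: "Linf_norm ?D (w m') < \<infinity>" for m' by simp

    define G where "G m' z = f (Inr m') z - w m' z" for m' z
    define k where "k m' = n2 m' + C3 * (\<Sum>m\<in>UNIV. n12 m m')" for m'
    have k: "k m' \<ge> 0" for m'
      using C3 nonneg by (auto simp: k_def intro!: add_nonneg_nonneg mult_nonneg_nonneg sum_nonneg)
    have G_est: "Holder_Linf_norm \<alpha>1 D1 D2 (G m') \<le> ennreal (k m')" for m'
    proof -
      have "Holder_Linf_norm \<alpha>1 D1 D2 (G m') \<le> ennreal (n2 m') + ennreal (C3 * (\<Sum>m\<in>UNIV. n12 m m'))"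
        unfolding G_def
        by (rule order_trans[OF Holder_Linf_norm_diff]) (intro add_mono w_est eq_refl n_eq)
      then show ?thesis
        using C3 nonneg by (simp add: k_def ennreal_plus sum_nonneg)
    qed
    have G_fin: "Holder_Linf_norm \<alpha>1 D1 D2 (G m') < \<infinity>" for m'
      using le_less_trans[OF G_est ennreal_less_top] by simp
    have G_fin': "Linf_norm ?D (G m') < \<infinity>" for m'
      by (rule le_less_trans[OF Linf_norm_le_Holder_Linf_norm G_fin])
    have G_loc: "locally_integrable ?D (G m')" for m'
      by (rule Linf_norm_locally_integrable[OF D_sets G_fin'])
    have int_G: "(LINT z|lebesgue_on ?D. G m' z * \<Phi> z) =
        (LINT z|lebesgue_on ?D. f (Inr m') z * \<Phi> z) - (LINT z|lebesgue_on ?D. w m' z * \<Phi> z)"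
      if "test_function ?D \<Phi>" for m' \<Phi>
      using Linf_norm_mult_integrable[OF D f_fin that] Linf_norm_mult_integrable[OF D w_fin that]
      by (simp add: G_def left_diff_distrib)
    have int_w: "(LINT z|lebesgue_on ?D. w m' z * \<Phi> z) =
        - (LINT z|lebesgue_on ?D. v z * dbar_at (prod_axis (Inr m')) \<Phi> z)" if "test_function ?D \<Phi>" for m' \<Phi>
      using v2[of m'] that unfolding weak_dbar_def by simp

    \<comment> \<open>The part from \<open>f\<close> is closed by assumption. The family
      \<open>w\<close> consists of the barred derivatives of the single function \<open>v\<close>,
      so it is closed because these derivatives commute on test functions.\<close>
    have "dbar_closed (\<lambda>i c. (0, axis i c)) ?D G"
      unfolding dbar_closed_def prod_axis_eq(2)[symmetric]
    proof (intro conjI allI impI G_loc)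
      fix i j \<Phi> assume \<Phi>: "test_function ?D \<Phi>"
      note d\<Phi> = test_function_dbar_at[OF \<Phi>]
      have "dbar_at (prod_axis (Inr i)) (dbar_at (prod_axis (Inr j)) \<Phi>) = dbar_at (prod_axis (Inr j)) (dbar_at (prod_axis (Inr i)) \<Phi>)"
        using dbar_at_commute[OF \<Phi>] by blast
      moreover have "(LINT z|lebesgue_on ?D. f (Inr i) z * dbar_at (prod_axis (Inr j)) \<Phi> z) =
          (LINT z|lebesgue_on ?D. f (Inr j) z * dbar_at (prod_axis (Inr i)) \<Phi> z)"
        using closed \<Phi> unfolding dbar_closed_def by blast
      ultimately show "(LINT z|lebesgue_on ?D. G i z * dbar_at (prod_axis (Inr j)) \<Phi> z) =
          (LINT z|lebesgue_on ?D. G j z * dbar_at (prod_axis (Inr i)) \<Phi> z)"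
        by (simp add: int_G[OF d\<Phi>] int_w[OF d\<Phi>])
    qed
    then have "dbar_solution (\<lambda>i c. (0, axis i c)) ?D (act2 T2 G) G"
      by (intro act2_solves_dbar[OF D1 D2 \<alpha>1 \<alpha>2 op2 solves2] G_fin)
    then have G2: "weak_dbar (prod_axis (Inr m')) ?D (act2 T2 G) (G m')" for m'
      unfolding dbar_solution_def prod_axis_eq by blast

    have zero: "Linf_norm ?D (\<lambda>z. 0) = 0"
      using Linf_norm_borel_le[of "\<lambda>z. 0" 0 ?D] by simp
    then have zero_fin: "Linf_norm ?D (\<lambda>z. 0) < \<infinity>" by simp
    have "weak_dbar (prod_axis (Inl m)) ?D (G m') (\<lambda>z. 0)" for m m'
      unfolding weak_dbar_def
    proof (intro conjI allI impI G_loc)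
      show "locally_integrable ?D (\<lambda>z. 0)"
        by (rule Linf_norm_locally_integrable[OF D_sets zero_fin])
      fix \<Phi> assume \<Phi>: "test_function ?D \<Phi>"
      note d\<Phi> = test_function_dbar_at[OF \<Phi>]
      let ?L1 = "prod_axis (Inl m)" and ?L2 = "prod_axis (Inr m')"
      have "(LINT z|lebesgue_on ?D. w m' z * dbar_at ?L1 \<Phi> z) =
          - (LINT z|lebesgue_on ?D. v z * dbar_at ?L2 (dbar_at ?L1 \<Phi>) z)"
        by (rule int_w[OF d\<Phi>])
      also have "\<dots> = - (LINT z|lebesgue_on ?D. v z * dbar_at ?L1 (dbar_at ?L2 \<Phi>) z)"
        using dbar_at_commute[OF \<Phi>, of ?L2 ?L1] by simp
      also have "\<dots> = (LINT z|lebesgue_on ?D. f (Inl m) z * dbar_at ?L2 \<Phi> z)"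
        using v1[of m] d\<Phi>[of ?L2] unfolding weak_dbar_def by simp
      \<comment> \<open>This is the mixed part of the closedness of \<open>f\<close>, the
        distributional form of dbar_2 f_1 = dbar_1 f_2, with one index from each factor.\<close>
      also have "\<dots> = (LINT z|lebesgue_on ?D. f (Inr m') z * dbar_at ?L1 \<Phi> z)"
        using closed \<Phi> unfolding dbar_closed_def by blast
      finally show "(LINT z|lebesgue_on ?D. G m' z * dbar_at ?L1 \<Phi> z) = - (LINT z|lebesgue_on ?D. 0 * \<Phi> z)"
        by (simp add: int_G[OF d\<Phi>])
    qed
    moreover have "Linf_form_norm ?D G < \<infinity>" "Linf_form_norm ?D (\<lambda>m' :: 'b. \<lambda>z. 0) < \<infinity>"
      using G_fin' zero by (simp_all add: Linf_form_norm_def)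
    ultimately have G1': "weak_dbar (prod_axis (Inl m)) ?D (act2 T2 G) (act2 T2 (\<lambda>m' z. 0))" for m
      using comm2[of m] unfolding commutes_dbar_def by blast
    \<comment> \<open>Linearity makes the image of the zero form vanish on \<open>D2\<close> only;
      outside, its values are unconstrained and do not matter.\<close>
    have act2_0: "AE z in lebesgue_on ?D. act2 T2 (\<lambda>m' z. 0) z = 0"
      by (rule AE_I2) (auto simp: act2_def bounded_operator_zero[OF op2])
    have G1: "weak_dbar (prod_axis (Inl m)) ?D (act2 T2 G) (\<lambda>z. 0)" for m
      by (rule weak_dbar_cong_AE[OF D(1) G1' zero_fin act2_0])

    have uG_est: "iterated_Holder_norm \<alpha>1 \<alpha>2 D1 D2 (act2 T2 G) \<le> ennreal (C2 * (\<Sum>m\<in>UNIV. k m))"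
      by (rule est2[OF k G_est])
    from le_less_trans[OF order_trans[OF Linf_norm_le_iterated_Holder_norm uG_est] ennreal_less_top]
    have uG_fin: "Linf_norm ?D (act2 T2 G) < \<infinity>" by simp

    define u where "u z = v z + act2 T2 G z" for z
    have "weak_dbar (prod_axis i) ?D u (f i)" for i
    proof (cases i)
      case (Inl m)
      then show ?thesis
        using weak_dbar_add[OF D v_fin uG_fin f_fin zero_fin v1 G1, of m] unfolding u_def by simp
    next
      case (Inr m')
      then show ?thesis
        using weak_dbar_add[OF D v_fin uG_fin w_fin G_fin' v2 G2, of m'] unfolding u_def G_def by simp
    qed
    then have "dbar_solution prod_axis ?D u f" by (simp add: dbar_solution_def)
    moreover have "iterated_Holder_norm \<alpha>1 \<alpha>2 D1 D2 u \<le> ennreal C *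
          ((\<Sum>m\<in>UNIV. Linf_Holder_norm \<alpha>2 D1 D2 (f (Inl m)))
           + (\<Sum>m\<in>UNIV. Holder_Linf_norm \<alpha>1 D1 D2 (f (Inr m)))
           + (\<Sum>m\<in>UNIV. \<Sum>m'\<in>UNIV. Linf_norm ?D (f12 m m')))"
    proof -
      define s1 where "s1 = (\<Sum>m\<in>UNIV. n1 m)"
      define s2 where "s2 = (\<Sum>m\<in>UNIV. n2 m)"
      define s12 where "s12 = (\<Sum>m\<in>UNIV. \<Sum>m'\<in>UNIV. n12 m m')"
      have s: "s1 \<ge> 0" "s2 \<ge> 0" "s12 \<ge> 0"
        unfolding s1_def s2_def s12_def by (intro sum_nonneg nonneg)+
      have ks: "(\<Sum>m\<in>UNIV. k m) = s2 + C3 * s12"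
        unfolding k_def s2_def s12_def sum.distrib sum_distrib_left[symmetric] by (subst sum.swap) simp
      have "iterated_Holder_norm \<alpha>1 \<alpha>2 D1 D2 u \<le> ennreal (C1 * s1) + ennreal (C2 * (s2 + C3 * s12))"
        unfolding u_def[abs_def] using v_est uG_est
        by (intro order_trans[OF iterated_Holder_norm_add] add_mono) (auto simp: s1_def ks)
      also have "\<dots> = ennreal (C1 * s1 + C2 * (s2 + C3 * s12))"
        using C1 C2 C3 s by (simp add: ennreal_plus)
      also have "\<dots> \<le> ennreal (C * (s1 + s2 + s12))"
      proof (rule ennreal_leI)
        \<comment> \<open>What remains after matching the three terms consists of nonnegative cross
          products.\<close>
        have "C * (s1 + s2 + s12) - (C1 * s1 + C2 * (s2 + C3 * s12)) =
            C1 * s2 + C1 * s12 + C2 * s1 + C2 * s12 + C2 * C3 * s1 + C2 * C3 * s2"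
          by (simp add: C_def algebra_simps)
        also have "\<dots> \<ge> 0" using C1 C2 C3 s by simp
        finally show "C1 * s1 + C2 * (s2 + C3 * s12) \<le> C * (s1 + s2 + s12)" by simp
      qed
      also have "\<dots> = ennreal C * (ennreal s1 + ennreal s2 + ennreal s12)"
        using s \<open>C \<ge> 0\<close> by (simp add: ennreal_mult ennreal_plus)
      finally show ?thesis
        using nonneg by (simp add: n_eq s1_def s2_def s12_def sum_ennreal sum_nonneg)
    qed
    ultimately show "\<exists>u. dbar_solution prod_axis ?D u f \<and>
        iterated_Holder_norm \<alpha>1 \<alpha>2 D1 D2 u \<le> ennreal C *
          ((\<Sum>m\<in>UNIV. Linf_Holder_norm \<alpha>2 D1 D2 (f (Inl m)))
           + (\<Sum>m\<in>UNIV. Holder_Linf_norm \<alpha>1 D1 D2 (f (Inr m)))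
           + (\<Sum>m\<in>UNIV. \<Sum>m'\<in>UNIV. Linf_norm ?D (f12 m m')))"
      by blast
  qed
qed

theorem theorem5p8:
  fixes D1 :: "(complex ^ 'a) set" and D2 :: "(complex ^ 'b) set"
    and \<alpha>1 \<alpha>2 :: real
    and T1 :: "('a, complex ^ 'a) form01 \<Rightarrow> complex ^ 'a \<Rightarrow> complex"
    and T2 :: "('b, complex ^ 'b) form01 \<Rightarrow> complex ^ 'b \<Rightarrow> complex"
  assumes "bounded_domain D1" and "bounded_domain D2"
    and "0 < \<alpha>1" and "\<alpha>1 < 1" and "0 < \<alpha>2" and "\<alpha>2 < 1"
    and "bounded_operator_Linf_Holder \<alpha>1 D1 T1"
    and "solves_dbar axis D1 T1"
    and "\<And>m :: 'b. commutes_dbar (prod_axis (Inr m)) (D1 \<times> D2) (act1 T1)"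
    and "bounded_operator_Linf_Holder \<alpha>2 D2 T2"
    and "solves_dbar axis D2 T2"
    and "\<And>m :: 'a. commutes_dbar (prod_axis (Inl m)) (D1 \<times> D2) (act2 T2)"
  shows "\<exists>(T :: ('a + 'b, (complex ^ 'a) \<times> (complex ^ 'b)) form01 \<Rightarrow>
               (complex ^ 'a) \<times> (complex ^ 'b) \<Rightarrow> complex) (C :: real).
    \<forall>f (f12 :: 'a \<Rightarrow> 'b \<Rightarrow> (complex ^ 'a) \<times> (complex ^ 'b) \<Rightarrow> complex).
      dbar_closed prod_axis (D1 \<times> D2) f \<and>
      (\<forall>m m'. weak_dbar (prod_axis (Inr m')) (D1 \<times> D2) (f (Inl m)) (f12 m m')) \<and>
      (\<forall>m m'. Linf_norm (D1 \<times> D2) (f12 m m') < \<infinity>) \<and>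
      (\<forall>m. Linf_Holder_norm \<alpha>2 D1 D2 (f (Inl m)) < \<infinity>) \<and>
      (\<forall>m. Holder_Linf_norm \<alpha>1 D1 D2 (f (Inr m)) < \<infinity>)
      \<longrightarrow>
      dbar_solution prod_axis (D1 \<times> D2) (T f) f \<and>
      iterated_Holder_norm \<alpha>1 \<alpha>2 D1 D2 (T f) \<le> ennreal C *
        ((\<Sum>m\<in>UNIV. Linf_Holder_norm \<alpha>2 D1 D2 (f (Inl m)))
         + (\<Sum>m\<in>UNIV. Holder_Linf_norm \<alpha>1 D1 D2 (f (Inr m)))
         + (\<Sum>m\<in>UNIV. \<Sum>m'\<in>UNIV. Linf_norm (D1 \<times> D2) (f12 m m')))"
proof -
  let ?D = "D1 \<times> D2"
  have D1: "open D1" "bounded D1" and D2: "open D2" "bounded D2"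
    using assms(1,2) by (auto simp: bounded_domain_def)
  have D: "open ?D" "bounded ?D"
    using D1 D2 by (auto intro: open_Times bounded_Times)
  define N where "N f = (\<Sum>m\<in>UNIV. Linf_Holder_norm \<alpha>2 D1 D2 (f (Inl m)))
         + (\<Sum>m\<in>UNIV. Holder_Linf_norm \<alpha>1 D1 D2 (f (Inr m)))"
    for f :: "('a + 'b, (complex ^ 'a) \<times> (complex ^ 'b)) form01"
  define P where "P f12 = (\<Sum>m\<in>UNIV. \<Sum>m'\<in>UNIV. Linf_norm ?D (f12 m m'))"
    for f12 :: "'a \<Rightarrow> 'b \<Rightarrow> (complex ^ 'a) \<times> (complex ^ 'b) \<Rightarrow> complex"
  define admissible where "admissible f f12 \<longleftrightarrow> dbar_closed prod_axis ?D f \<and>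
      (\<forall>m m'. weak_dbar (prod_axis (Inr m')) ?D (f (Inl m)) (f12 m m')) \<and>
      (\<forall>m m'. Linf_norm ?D (f12 m m') < \<infinity>) \<and>
      (\<forall>m. Linf_Holder_norm \<alpha>2 D1 D2 (f (Inl m)) < \<infinity>) \<and>
      (\<forall>m. Holder_Linf_norm \<alpha>1 D1 D2 (f (Inr m)) < \<infinity>)" for f f12
  have "\<exists>C\<ge>0::real. \<forall>f f12. admissible f f12 \<longrightarrow> (\<exists>u. dbar_solution prod_axis ?D u f \<and>
      iterated_Holder_norm \<alpha>1 \<alpha>2 D1 D2 u \<le> ennreal C * (N f + P f12))"
    unfolding admissible_def N_def P_def
    by (rule dbar_solution_exists[OF D1 D2 assms(3,5,7-12)])
  then obtain C where C: "C \<ge> 0" and sol: "\<And>f f12. admissible f f12 \<Longrightarrow>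
      \<exists>u. dbar_solution prod_axis ?D u f \<and> iterated_Holder_norm \<alpha>1 \<alpha>2 D1 D2 u \<le> ennreal C * (N f + P f12)"
    by blast
  \<comment> \<open>The solution may depend on \<open>f\<close> only, while the bound is required for every representative
    \<open>f12\<close> of the mixed derivative. Choosing one of nearly minimal norm avoids a proof that weak
    derivatives are unique almost everywhere.\<close>
  have near_min: "\<exists>f12'. admissible f f12' \<and> (\<forall>f12. admissible f f12 \<longrightarrow> P f12' \<le> N f + P f12)"
    if adm: "admissible f f12" for f f12
  \<comment> \<open>When \<open>N f = 0\<close> there is no slack above the infimum, but then the
    coefficients in the first variables vanish almost everywhere and zero is itself a mixed
    derivative, with \<open>P\<close> equal to 0.\<close>
  proof (cases "N f = 0")
    case True
    have "weak_dbar (prod_axis (Inr m')) ?D (f (Inl m)) (\<lambda>z. 0)" for m m'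
    proof -
      have "Linf_Holder_norm \<alpha>2 D1 D2 (f (Inl m)) = 0"
        using True by (simp add: N_def add_eq_0_iff_both_eq_0 sum_nonneg_eq_0_iff)
      then have "Linf_norm ?D (f (Inl m)) \<le> ennreal 0"
        using Linf_norm_le_Linf_Holder_norm[of D1 D2 "f (Inl m)" \<alpha>2] by simp
      then have f0: "AE z in lebesgue_on ?D. f (Inl m) z = 0"
        by (simp only: Linf_norm_le_iff[OF order_refl]) auto
      have w: "weak_dbar (prod_axis (Inr m')) ?D (f (Inl m)) (f12 m m')"
        using adm by (simp add: admissible_def)
      have "(LINT z|lebesgue_on ?D. f (Inl m) z * \<phi> z) = 0" for \<phi>
        using f0 by (intro integral_eq_zero_AE) (auto elim!: eventually_mono)
      then show ?thesis
        using w by (auto simp: weak_dbar_def locally_integrable_def)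
    qed
    moreover have "Linf_norm ?D (\<lambda>z. 0) = 0"
      using Linf_norm_borel_le[of "\<lambda>z. 0" 0 ?D] by simp
    ultimately show ?thesis
      using adm by (intro exI[of _ "\<lambda>m m' z. 0"]) (simp add: admissible_def P_def)
  next
    case False
    define I where "I = (INF f12\<in>Collect (admissible f). P f12)"
    have "I \<le> P f12" unfolding I_def using adm by (intro INF_lower) simp
    also have "P f12 < \<infinity>" using adm by (simp add: P_def admissible_def)
    \<comment> \<open>The infimum is finite and \<open>N f\<close> is positive, so some
      representative lies strictly below \<open>I + N f\<close>; the excess is paid for by the term
      \<open>N f\<close> of the estimate.\<close>
    finally have "I < I + N f"
      using False by (cases I; cases "N f") (auto simp: ennreal_less_iff simp flip: ennreal_plus)
    then obtain f12' where "admissible f f12'" "P f12' < I + N f"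
      unfolding I_def INF_less_iff by auto
    moreover have "I \<le> P f12" if "admissible f f12" for f12
      unfolding I_def using that by (intro INF_lower) simp
    ultimately show ?thesis
      by (metis add.commute add_left_mono less_imp_le order_trans)
  qed
  \<comment> \<open>Now \<open>u\<close> precedes \<open>f12\<close> in the order of the
    quantifiers. The constant doubles because \<open>N f\<close> is counted once in the bound for
    the chosen \<open>f12'\<close> and once more for its excess over the infimum. If
    \<open>f\<close> has no admissible \<open>f12\<close>, any \<open>u\<close> serves.\<close>
  have "\<exists>u. \<forall>f12. admissible f f12 \<longrightarrow> dbar_solution prod_axis ?D u f \<and>
      iterated_Holder_norm \<alpha>1 \<alpha>2 D1 D2 u \<le> ennreal (2 * C) * (N f + P f12)" for f
  proof (cases "\<exists>f12. admissible f f12")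
    case True
    then obtain f12' where f12': "admissible f f12'" "\<And>f12. admissible f f12 \<Longrightarrow> P f12' \<le> N f + P f12"
      using near_min by metis
    obtain u where u: "dbar_solution prod_axis ?D u f"
      "iterated_Holder_norm \<alpha>1 \<alpha>2 D1 D2 u \<le> ennreal C * (N f + P f12')"
      using sol[OF f12'(1)] by blast
    have "iterated_Holder_norm \<alpha>1 \<alpha>2 D1 D2 u \<le> ennreal (2 * C) * (N f + P f12)" if "admissible f f12" for f12
    proof -
      have "N f + P f12' \<le> N f + (N f + P f12)"
        using f12'(2)[OF that] by (rule add_left_mono)
      also have "\<dots> \<le> 2 * (N f + P f12)"
        by (simp add: mult_2 distrib_left add_increasing2 add.assoc add_left_mono)
      finally have "ennreal C * (N f + P f12') \<le> ennreal C * (2 * (N f + P f12))"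
        by (rule mult_left_mono) simp
      also have "\<dots> = ennreal (2 * C) * (N f + P f12)"
        using C by (simp add: ennreal_mult mult.assoc mult.left_commute)
      finally show ?thesis using u(2) by (rule order_trans[rotated])
    qed
    with u(1) show ?thesis by blast
  qed blast
  then obtain T where "\<forall>f f12. admissible f f12 \<longrightarrow> dbar_solution prod_axis ?D (T f) f \<and>
      iterated_Holder_norm \<alpha>1 \<alpha>2 D1 D2 (T f) \<le> ennreal (2 * C) * (N f + P f12)"
    by metis
  then show ?thesis
    unfolding admissible_def N_def P_def by blast
qed

end
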